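(* Let $n\ge3$, let $W$ be i.i.d. $U[0,1]$ edge weights on the complete graph $K_n$, let $S$ be the set of tours of $K_n$ and $J(x\mid W)=\sum_{e\in x}W(e)$. Suppose simulated annealing is executed with the 2-opt neighborhood for $t=2^{o(n)}$ epochs with the logarithmic cooling schedule $T(k)=a/\ln k$ at epoch $k$, where $a\ge n$. Assume that at epoch $k$ the temperature is kept constant for $\Omega(n^9k^2\log n)$ iterations. Let $J(t)$ denote the length of the tour at the end of epoch $t$. Then \[ \mathbb{E}(J(t))\ \ge\ n\left(\frac{a}{\ln t}-\frac{1}{t^{1/a}-1}\right), \] where the expectation is over both $W$ and the randomness of the algorithm.
   Context: Simulated annealing: from the current tour $x$, a tour $y\in N(x)$ is chosen uniformly at random and accepted with probability $\min\{1,\exp(-(J(y\mid W)-J(x\mid W))/T)\}$, where $T$ is the current temperature; otherwise the chain stays at $x$. An epoch is a maximal sequence of consecutive iterations during which the temperature is held constant; during epoch $k$ the temperature is $a/\ln k$. The 2-opt neighborhood $N(x)$ of a tour $x$ consists of all tours obtained by deleting two non-adjacent edges of $x$ and reconnecting the two resulting paths into a different tour; the resulting state graph on $S$ is undirected and $n(n-3)/2$-regular, with $|S|=(n-1)!/2$. Asymptotic notation is as $n\to\infty$. *)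

theory Defs
  imports "HOL-Probability.Probability" "HOL-Combinatorics.Combinatorics"
    "HOL-Library.Landau_Symbols"
begin

definition edges :: "nat \<Rightarrow> nat set set" where
  "edges n = {{u, v} |u v. u < n \<and> v < n \<and> u \<noteq> v}"

definition cycle_edges :: "nat list \<Rightarrow> nat set set" where
  "cycle_edges xs = {{xs ! i, xs ! (Suc i mod length xs)} |i. i < length xs}"

text \<open>A tour is identified with its edge set, so that rotations and reversals of a vertex
  sequence give the same tour.\<close>

definition tours :: "nat \<Rightarrow> nat set set set" where
  "tours n = cycle_edges ` permutations_of_set {..<n}"

definition tour_length :: "(nat set \<Rightarrow> real) \<Rightarrow> nat set set \<Rightarrow> real" where
  "tour_length W x = (\<Sum>e\<in>x. W e)"

definition two_opt :: "nat \<Rightarrow> nat set set \<Rightarrow> nat set set set" where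
  "two_opt n x = {y \<in> tours n. y \<noteq> x \<and>
     (\<exists>e\<in>x. \<exists>f\<in>x. e \<inter> f = {} \<and>
       (\<exists>e'\<in>edges n. \<exists>f'\<in>edges n. y = (x - {e, f}) \<union> {e', f'}))}"

definition accept_prob :: "(nat set \<Rightarrow> real) \<Rightarrow> real \<Rightarrow> nat set set \<Rightarrow> nat set set \<Rightarrow> real" where
  "accept_prob W T x y = min 1 (exp (- (tour_length W y - tour_length W x) / T))"

text \<open>The triangle (\<open>n = 3\<close>) has no 2-opt neighbour; the chain then stays where it is.\<close>

definition sa_step :: "nat \<Rightarrow> (nat set \<Rightarrow> real) \<Rightarrow> real \<Rightarrow> nat set set \<Rightarrow> nat set set pmf" where
  "sa_step n W T x =
    (if two_opt n x = {} then return_pmf x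
     else do {
       y \<leftarrow> pmf_of_set (two_opt n x);
       b \<leftarrow> bernoulli_pmf (accept_prob W T x y);
       return_pmf (if b then y else x)
     })"

text \<open>In epoch 1 the temperature \<open>a / ln 1\<close> is infinite, so every proposal is accepted. In HOL
  \<open>a / ln 1 = 0\<close>, but division by this \<open>0\<close> in \<open>accept_prob\<close> gives \<open>exp 0 = 1\<close>, which is
  the same acceptance probability.\<close>

definition temperature :: "real \<Rightarrow> nat \<Rightarrow> real" where
  "temperature a k = a / ln (real k)"

text \<open>Law of the current tour at the end of epoch \<open>k\<close> for fixed weights \<open>W\<close>, when epoch \<open>j\<close>
  lasts \<open>m j\<close> iterations and the initial tour has law \<open>p\<close>.\<close>

primrec sa_law :: "nat \<Rightarrow> (nat set \<Rightarrow> real) \<Rightarrow> real \<Rightarrow> (nat \<Rightarrow> nat) \<Rightarrow> nat set set pmf \<Rightarrow> nat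
    \<Rightarrow> nat set set pmf" where
  "sa_law n W a m p 0 = p"
| "sa_law n W a m p (Suc k) =
    ((\<lambda>q. bind_pmf q (sa_step n W (temperature a (Suc k)))) ^^ m (Suc k)) (sa_law n W a m p k)"

definition weight_measure :: "nat \<Rightarrow> (nat set \<Rightarrow> real) measure" where
  "weight_measure n = Pi\<^sub>M (edges n) (\<lambda>_. uniform_measure lborel {0..1})"

text \<open>The law \<open>p\<close> of the initial tour does not depend on \<open>W\<close>: the initial tour is drawn
  independently of the weights.\<close>

definition expected_final_length ::
    "nat \<Rightarrow> real \<Rightarrow> (nat \<Rightarrow> nat) \<Rightarrow> nat set set pmf \<Rightarrow> nat \<Rightarrow> real" where
  "expected_final_length n a m p t =
    (\<integral>W. measure_pmf.expectation (sa_law n W a m p t) (tour_length W) \<partial>weight_measure n)"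

end

theory Submission imports Defs "HOL-Real_Asymp.Real_Asymp" begin

text \<open>
  Put \<open>\<beta> = ln t / a\<close> and let \<open>g\<close> be the mean of the density proportional to \<open>exp (- \<beta> w)\<close> on
  \<open>[0, 1]\<close>, so that the claimed bound is \<open>n g\<close>. Writing \<open>P\<^sub>e(W)\<close> for the probability that the final
  tour contains \<open>e\<close>, the expected length is the sum over \<open>e\<close> of the expectation of \<open>W\<^sub>e P\<^sub>e\<close>, and
  the \<open>P\<^sub>e\<close> sum to \<open>n\<close>. Hence it suffices that \<open>W\<^sub>e - g\<close> and \<open>P\<^sub>e\<close> have a nonnegative inner
  product, which by Chebyshev's association inequality holds if \<open>exp (\<beta> w) P\<^sub>e\<close> is nondecreasing
  in \<open>w = W\<^sub>e\<close>.

  For the Gibbs measure this function is \<open>A / (A exp (- \<beta> w) + B)\<close>, which increases at a rate of at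
  least \<open>\<beta>\<close> times a quantity exponentially small in \<open>n log n\<close>. The annealing chain differs from the
  Gibbs measure by an error whose increments in \<open>w\<close> are at most \<open>\<beta>\<close> times a much smaller quantity:
  a transition kernel changes by \<open>O(\<beta> \<delta>)\<close> when \<open>w\<close> changes by \<open>\<delta>\<close>, and the last epoch is
  exponentially contracting. The contraction rate comes from a Poincare inequality for the 2-opt
  graph: a transposition of two far apart positions of a tour is a product of two segment
  reversals.
\<close>

section \<open>Metropolis chains on regular graphs\<close>

text \<open>That the chain is close to the Gibbs measure does not by itself give monotonicity in an
  edge weight: the two weights compared may be arbitrarily close, so the gain of the Gibbs term and
  the change of the error must both be proportional to their difference. Hence the error and its
  change under a perturbation \<delta> of the energy are estimated separately, and both bounds must
  be exponentially small in the length of the last epoch. The earlier epochs can afford a crude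
  bound, linear in their number. The Poincare inequality concerns pairs of neighbours of a common
  state, because one step of the chain loses at least a weighted sum of such squared differences. In
  this form it yields decay without laziness and without a discussion of negative eigenvalues.
  Sizes: \<open>a \<ge> n\<close> keeps energies below ln t, so unnormalised Gibbs weights lie in
  [1/t, 1]. The rate is of order 1/(n^6 t), with n^4 from the squared degree and n^2 from the
  Poincare constant. An epoch of order n^9 t^2 ln n then gives the exponent n^3 t ln n, against the
  cube of the number of tours, at most n^(3n).\<close>

locale metropolis_graph =
  fixes S :: "'a set" and N :: "'a \<Rightarrow> 'a set" and d :: nat and A :: real
  assumes finite_S: "finite S" and S_nonempty: "S \<noteq> {}"
    and N_subset: "x \<in> S \<Longrightarrow> N x \<subseteq> S"
    and N_sym: "x \<in> S \<Longrightarrow> y \<in> N x \<Longrightarrow> x \<in> N y"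
    and card_N: "x \<in> S \<Longrightarrow> card (N x) = d" and d_pos: "d > 0"
    and poincare: "(\<Sum>x\<in>S. (f x - (\<Sum>z\<in>S. f z) / card S)\<^sup>2)
      \<le> A * (\<Sum>z\<in>S. \<Sum>x\<in>N z. \<Sum>y\<in>N z. (f x - f y)\<^sup>2)"
begin

definition acc :: "('a \<Rightarrow> real) \<Rightarrow> 'a \<Rightarrow> 'a \<Rightarrow> real" where
  "acc U x y = exp (- max 0 (U y - U x))"

text \<open>The Markov operator on observables: \<open>step U f x\<close> is the expected value of
  \<open>f\<close> after one move from \<open>x\<close>. Working dually to the laws makes the last
  epoch act first, which is the recursion of \<open>run\<close>.\<close>

definition step :: "('a \<Rightarrow> real) \<Rightarrow> ('a \<Rightarrow> real) \<Rightarrow> 'a \<Rightarrow> real" where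
  "step U f x = f x + (\<Sum>y\<in>N x. acc U x y * (f y - f x)) / d"

definition gibbs :: "('a \<Rightarrow> real) \<Rightarrow> ('a \<Rightarrow> real) \<Rightarrow> real" where
  "gibbs U f = (\<Sum>x\<in>S. exp (- U x) * f x) / (\<Sum>x\<in>S. exp (- U x))"

lemma partition_pos: "(\<Sum>x\<in>S. exp (- U x :: real)) > 0"
  using finite_S S_nonempty by (intro sum_pos) auto

text \<open>Detailed balance: either side is exp (- max (U x) (U y)).\<close>

lemma acc_reversible: "exp (- U x) * acc U x y = exp (- U y) * acc U y x"
  by (simp add: acc_def max_def flip: exp_add)

lemma acc_bounds: "0 < acc U x y" "acc U x y \<le> 1"
  by (auto simp: acc_def)

lemma sum_neighbors_swap: "(\<Sum>x\<in>S. \<Sum>y\<in>N x. g x y) = (\<Sum>x\<in>S. \<Sum>y\<in>N x. (g y x :: real))"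
proof -
  have eq: "(\<Sum>x\<in>S. \<Sum>y\<in>N x. h x y) = (\<Sum>x\<in>S. \<Sum>y\<in>S. if y \<in> N x then h x y else 0)"
    for h :: "'a \<Rightarrow> 'a \<Rightarrow> real"
  proof (rule sum.cong[OF refl])
    fix x assume "x \<in> S"
    then have "S \<inter> {y. y \<in> N x} = N x"
      using N_subset by auto
    then show "(\<Sum>y\<in>N x. h x y) = (\<Sum>y\<in>S. if y \<in> N x then h x y else 0)"
      by (simp add: sum.If_cases finite_S)
  qed
  have "(\<Sum>x\<in>S. \<Sum>y\<in>N x. g x y) = (\<Sum>y\<in>S. \<Sum>x\<in>S. if y \<in> N x then g x y else 0)"
    unfolding eq by (rule sum.swap)
  also have "\<dots> = (\<Sum>y\<in>S. \<Sum>x\<in>S. if x \<in> N y then g x y else 0)"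
    using N_sym by (intro sum.cong refl) auto
  also have "\<dots> = (\<Sum>x\<in>S. \<Sum>y\<in>N x. g y x)"
    unfolding eq ..
  finally show ?thesis .
qed

text \<open>Stationarity of the Gibbs weights. Exchanging the two ends of a move turns the net flow
  \<open>I\<close> into its negative, by detailed balance.\<close>

lemma step_sum:
  "(\<Sum>x\<in>S. exp (- U x) * step U f x) = (\<Sum>x\<in>S. exp (- U x) * f x)"
proof -
  define I where "I = (\<Sum>x\<in>S. \<Sum>y\<in>N x. exp (- U x) * acc U x y * (f y - f x))"
  have "I = (\<Sum>x\<in>S. \<Sum>y\<in>N x. exp (- U y) * acc U y x * (f x - f y))"
    unfolding I_def by (rule sum_neighbors_swap)
  also have "\<dots> = (\<Sum>x\<in>S. \<Sum>y\<in>N x. - (exp (- U x) * acc U x y * (f y - f x)))"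
    unfolding acc_reversible[of U] by (intro sum.cong refl) (simp add: algebra_simps acc_reversible)
  also have "\<dots> = - I"
    by (simp add: I_def sum_negf)
  finally have "I = 0" by simp
  have "(\<Sum>x\<in>S. exp (- U x) * step U f x) = (\<Sum>x\<in>S. exp (- U x) * f x) + I / d"
    by (simp add: step_def I_def algebra_simps sum.distrib sum_distrib_left sum_divide_distrib)
  with \<open>I = 0\<close> show ?thesis by simp
qed

lemma gibbs_step: "gibbs U (step U f) = gibbs U f"
  by (simp add: gibbs_def step_sum)

lemma gibbs_steps: "gibbs U ((step U ^^ s) f) = gibbs U f"
  by (induction s) (simp_all add: gibbs_step)

lemma step_const: "step U (\<lambda>_. c) = (\<lambda>_. c)"
  by (simp add: step_def fun_eq_iff)

lemma step_add: "step U (\<lambda>x. f x + g x) = (\<lambda>x. step U f x + step U g x)"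
  by (simp add: step_def fun_eq_iff algebra_simps sum.distrib sum_subtractf add_divide_distrib diff_divide_distrib)

lemma step_diff: "step U (\<lambda>x. f x - g x) = (\<lambda>x. step U f x - step U g x)"
  by (simp add: step_def fun_eq_iff algebra_simps sum.distrib sum_subtractf add_divide_distrib diff_divide_distrib)

lemma steps_diff: "(step U ^^ s) (\<lambda>x. f x - g x) = (\<lambda>x. (step U ^^ s) f x - (step U ^^ s) g x)"
  by (induction s) (simp_all add: step_diff)

lemma steps_const: "(step U ^^ s) (\<lambda>_. c) = (\<lambda>_. c)"
  by (induction s) (simp_all add: step_const)

lemma gibbs_diff: "gibbs U (\<lambda>x. f x - g x) = gibbs U f - gibbs U g"
  by (simp add: gibbs_def right_diff_distrib sum_subtractf diff_divide_distrib)

lemma gibbs_add: "gibbs U (\<lambda>x. f x + g x) = gibbs U f + gibbs U g"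
  by (simp add: gibbs_def distrib_left sum.distrib add_divide_distrib)

lemma gibbs_cong: "(\<And>x. x \<in> S \<Longrightarrow> U x = V x) \<Longrightarrow> gibbs U f = gibbs V f"
  by (simp add: gibbs_def)

lemma gibbs_const: "gibbs U (\<lambda>_. c) = c"
  using partition_pos[of U] by (simp add: gibbs_def flip: sum_distrib_right)

lemma step_bound:
  assumes "\<And>x. x \<in> S \<Longrightarrow> \<bar>f x\<bar> \<le> M" and x: "x \<in> S"
  shows "\<bar>step U f x\<bar> \<le> M"
proof -
  \<comment> \<open>There are exactly \<open>d\<close> proposals, so the rejected mass at
    \<open>x\<close> can be shared among them; what remains is a mean of convex combinations of
    \<open>f x\<close> and \<open>f y\<close>.\<close>
  have eq: "step U f x = (\<Sum>y\<in>N x. (1 - acc U x y) * f x + acc U x y * f y) / d"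
    using d_pos card_N[OF x]
    by (simp add: step_def field_simps sum.distrib sum_subtractf sum_distrib_left sum_distrib_right)
  have "\<bar>(\<Sum>y\<in>N x. (1 - acc U x y) * f x + acc U x y * f y)\<bar> \<le> (\<Sum>y\<in>N x. M)"
  proof (rule order_trans[OF sum_abs sum_mono])
    fix y assume "y \<in> N x"
    then have y: "\<bar>f y\<bar> \<le> M" "\<bar>f x\<bar> \<le> M"
      using assms N_subset by auto
    have "\<bar>(1 - acc U x y) * f x + acc U x y * f y\<bar> \<le> (1 - acc U x y) * \<bar>f x\<bar> + acc U x y * \<bar>f y\<bar>"
      using acc_bounds[of U x y] by (intro order_trans[OF abs_triangle_ineq]) (simp add: abs_mult)
    also have "\<dots> \<le> (1 - acc U x y) * M + acc U x y * M"
      using acc_bounds[of U x y] y by (intro add_mono mult_left_mono) auto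
    finally show "\<bar>(1 - acc U x y) * f x + acc U x y * f y\<bar> \<le> M"
      by (simp add: algebra_simps)
  qed
  also have "\<dots> = d * M"
    using card_N[OF x] by simp
  finally show ?thesis
    unfolding eq using d_pos by (simp add: field_simps)
qed

lemma steps_bound:
  assumes "\<And>x. x \<in> S \<Longrightarrow> \<bar>f x\<bar> \<le> M" and "x \<in> S"
  shows "\<bar>(step U ^^ s) f x\<bar> \<le> M"
  using assms(2)
proof (induction s arbitrary: x)
  case (Suc s)
  then show ?case by (auto intro: step_bound)
qed (use assms in auto)

section \<open>Decay of the Gibbs variance\<close>

definition spread :: "('a \<Rightarrow> real) \<Rightarrow> ('a \<Rightarrow> real) \<Rightarrow> real" where
  "spread U f = (\<Sum>x\<in>S. exp (- U x) * (f x - gibbs U f)\<^sup>2)"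

text \<open>The parallel axis identity; \<open>spread\<close> is the Gibbs variance times the
  partition function. The centre \<open>c = 0\<close> turns second moments into spreads, a general
  centre gives the minimality of the mean.\<close>

lemma spread_decomp:
  "(\<Sum>x\<in>S. exp (- U x) * (f x - c)\<^sup>2) = spread U f + (\<Sum>x\<in>S. exp (- U x)) * (gibbs U f - c)\<^sup>2"
proof -
  define Z where "Z = (\<Sum>x\<in>S. exp (- U x))"
  define g where "g = gibbs U f"
  have gz: "(\<Sum>x\<in>S. exp (- U x) * f x) = g * Z"
    using partition_pos[of U] by (simp add: g_def gibbs_def Z_def)
  have "(\<Sum>x\<in>S. exp (- U x) * (f x - c)\<^sup>2)
      = (\<Sum>x\<in>S. exp (- U x) * (f x - g)\<^sup>2 + 2 * (g - c) * (exp (- U x) * f x)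
            - exp (- U x) * (2 * (g - c) * g) + exp (- U x) * (g - c)\<^sup>2)"
    by (intro sum.cong refl) (simp add: power2_eq_square algebra_simps)
  also have "\<dots> = spread U f + 2 * (g - c) * (g * Z) - Z * (2 * (g - c) * g) + Z * (g - c)\<^sup>2"
    by (simp add: sum.distrib sum_subtractf spread_def Z_def g_def gz[unfolded g_def Z_def]
        flip: sum_distrib_left sum_distrib_right)
  finally show ?thesis
    by (simp add: Z_def g_def)
qed

lemma spread_le: "spread U f \<le> (\<Sum>x\<in>S. exp (- U x) * (f x - c)\<^sup>2)"
  unfolding spread_decomp using partition_pos[of U] by simp

text \<open>The left-hand side is half the sum of squared differences of two independent samples from
  the transition kernel, restricted to accepted proposals.\<close>

lemma jensen_gap_step:
  assumes x: "x \<in> S"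
  shows "(\<Sum>y\<in>N x. \<Sum>z\<in>N x. acc U x y * acc U x z * (f y - f z)\<^sup>2) / (2 * d\<^sup>2)
    \<le> step U (\<lambda>y. (f y)\<^sup>2) x - (step U f x)\<^sup>2"
proof -
  define p where "p y = acc U x y / d" for y
  define u where "u y = f y - f x" for y
  define P where "P = (\<Sum>y\<in>N x. p y)"
  define E where "E = (\<Sum>y\<in>N x. p y * u y)"
  define Q where "Q = (\<Sum>y\<in>N x. p y * (u y)\<^sup>2)"
  have "(\<Sum>y\<in>N x. acc U x y) \<le> d"
    using sum_mono[of "N x" "acc U x" "\<lambda>_. 1"] acc_bounds card_N[OF x] by simp
  then have P: "P \<le> 1"
    using d_pos by (simp add: P_def p_def field_simps flip: sum_divide_distrib)
  have "Q \<ge> 0"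
    unfolding Q_def p_def by (intro sum_nonneg) (auto simp: less_imp_le acc_bounds)
  have "(\<Sum>y\<in>N x. \<Sum>z\<in>N x. acc U x y * acc U x z * (f y - f z)\<^sup>2) / (2 * d\<^sup>2)
      = (\<Sum>y\<in>N x. \<Sum>z\<in>N x. p y * p z * (u y - u z)\<^sup>2) / 2"
    using d_pos by (simp add: p_def u_def sum_divide_distrib power2_eq_square mult_ac)
  also have "\<dots> = (\<Sum>y\<in>N x. \<Sum>z\<in>N x. (p y * (u y)\<^sup>2) * p z - (2 * (p y * u y)) * (p z * u z) + p y * (p z * (u z)\<^sup>2)) / 2"
    by (simp add: power2_eq_square algebra_simps)
  also have "\<dots> = P * Q - E\<^sup>2"
    unfolding sum.distrib sum_subtractf sum_product[symmetric] sum_distrib_left[of 2, symmetric]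
    by (simp add: P_def Q_def E_def power2_eq_square)
  also have "\<dots> \<le> Q - E\<^sup>2"
    using mult_right_mono[OF P \<open>Q \<ge> 0\<close>] by simp
  also have "\<dots> = step U (\<lambda>y. (f y)\<^sup>2) x - (step U f x)\<^sup>2"
  proof -
    have "step U f x = f x + E"
      by (simp add: step_def E_def p_def u_def sum_divide_distrib)
    moreover have "step U (\<lambda>y. (f y)\<^sup>2) x = (f x)\<^sup>2 + (Q + 2 * f x * E)"
      unfolding step_def Q_def E_def p_def u_def sum_divide_distrib sum_distrib_left sum.distrib[symmetric]
      using d_pos by (intro arg_cong2[where f = "(+)"] sum.cong refl) (simp add: power2_eq_square field_simps)
    ultimately show ?thesis
      by (simp add: power2_eq_square algebra_simps)
  qed
  finally show ?thesis .
qed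

text \<open>The first two conditions place the unnormalised Gibbs weights in [1/B, 1], which
  compares Gibbs sums with uniform ones. The last keeps every acceptance probability at least exp
  (-2).\<close>

definition admissible :: "real \<Rightarrow> ('a \<Rightarrow> real) \<Rightarrow> bool" where
  "admissible B U \<longleftrightarrow> (\<forall>x\<in>S. 0 \<le> U x \<and> exp (U x) \<le> B \<and> (\<forall>y\<in>N x. U y \<le> U x + 2))"

lemma admissible_pos: "admissible B U \<Longrightarrow> B > 0"
  unfolding admissible_def using S_nonempty exp_gt_zero by (metis ex_in_conv less_le_trans)

text \<open>By stationarity the Gibbs sum of the Jensen gaps is the loss of \<open>spread\<close> in
  one step. Each gap sees all pairs of neighbours, weighted by two acceptances of at least exp (-2)
  and a Gibbs weight of at least 1/B; hence exp 4 and \<open>B\<close> in the condition on \<gamma>.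
  Conversely, weights of at most 1 bound \<open>spread\<close> by the uniform sum of squares, to
  which the Poincare inequality applies.\<close>

lemma spread_step:
  assumes U: "admissible B U" and \<gamma>: "2 * exp 4 * d\<^sup>2 * A * B * \<gamma> \<le> 1" "\<gamma> > 0"
  shows "spread U (step U f) \<le> (1 - \<gamma>) * spread U f"
proof -
  note B = admissible_pos[OF U]
  define Q where "Q = (\<Sum>z\<in>S. \<Sum>x\<in>N z. \<Sum>y\<in>N z. (f x - f y)\<^sup>2)"
  define m where "m = (\<Sum>z\<in>S. f z) / card S"
  have "spread U f \<le> (\<Sum>x\<in>S. exp (- U x) * (f x - m)\<^sup>2)"
    by (rule spread_le)
  also have "\<dots> \<le> (\<Sum>x\<in>S. (f x - m)\<^sup>2)"
    using U by (intro sum_mono mult_left_le_one_le) (auto simp: admissible_def)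
  also have "\<dots> \<le> A * Q"
    unfolding Q_def m_def by (rule poincare)
  finally have V: "spread U f \<le> A * Q" .
  have "Q * (exp (-4) / (2 * d\<^sup>2 * B)) = (\<Sum>z\<in>S. 1 / B * ((\<Sum>x\<in>N z. \<Sum>y\<in>N z. exp (-4) * (f x - f y)\<^sup>2) / (2 * d\<^sup>2)))"
    by (simp add: Q_def sum_distrib_left sum_distrib_right sum_divide_distrib field_simps)
  also have "\<dots> \<le> (\<Sum>z\<in>S. exp (- U z) * ((\<Sum>x\<in>N z. \<Sum>y\<in>N z. acc U z x * acc U z y * (f x - f y)\<^sup>2) / (2 * d\<^sup>2)))"
  proof (intro sum_mono mult_mono divide_right_mono mult_right_mono)
    fix z assume z: "z \<in> S"
    then have "exp (U z) \<le> B" using U by (auto simp: admissible_def)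
    then show "1 / B \<le> exp (- U z)"
      using B by (simp add: exp_minus field_simps)
    fix x y assume xy: "x \<in> N z" "y \<in> N z"
    have "exp (-2) \<le> acc U z w" if "w \<in> N z" for w
    proof -
      have "U w \<le> U z + 2"
        using U z that by (auto simp: admissible_def)
      then show ?thesis
        by (simp add: acc_def)
    qed
    then have "exp (-2) * exp (-2) \<le> acc U z x * acc U z y"
      using xy by (intro mult_mono) (auto simp: less_imp_le acc_bounds)
    then show "exp (-4) \<le> acc U z x * acc U z y"
      by (simp flip: exp_add)
  qed (auto intro!: sum_nonneg divide_nonneg_nonneg mult_nonneg_nonneg less_imp_le[OF acc_bounds(1)])
  also have "\<dots> \<le> (\<Sum>z\<in>S. exp (- U z) * (step U (\<lambda>y. (f y)\<^sup>2) z - (step U f z)\<^sup>2))"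
    by (intro sum_mono mult_left_mono jensen_gap_step) auto
  also have "\<dots> = (\<Sum>z\<in>S. exp (- U z) * (f z)\<^sup>2) - (\<Sum>z\<in>S. exp (- U z) * (step U f z)\<^sup>2)"
    by (simp add: right_diff_distrib sum_subtractf step_sum)
  also have "\<dots> = spread U f - spread U (step U f)"
    using spread_decomp[of U f 0] spread_decomp[of U "step U f" 0] by (simp add: gibbs_step)
  finally have drop: "Q * (exp (-4) / (2 * d\<^sup>2 * B)) \<le> spread U f - spread U (step U f)" .
  have "Q \<ge> 0" unfolding Q_def by (intro sum_nonneg) auto
  have "A * \<gamma> \<le> exp (-4) / (2 * d\<^sup>2 * B)"
    using \<gamma>(1) d_pos B by (simp add: exp_minus field_simps)
  from mult_right_mono[OF this \<open>Q \<ge> 0\<close>] have "\<gamma> * (A * Q) \<le> Q * (exp (-4) / (2 * d\<^sup>2 * B))"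
    by (simp add: mult_ac)
  moreover have "\<gamma> * spread U f \<le> \<gamma> * (A * Q)"
    using V \<gamma>(2) by simp
  ultimately show ?thesis
    using drop by (simp add: algebra_simps)
qed


lemma spread_nonneg: "spread U f \<ge> 0"
  unfolding spread_def by (intro sum_nonneg) auto

text \<open>Variance controls every single state because its Gibbs weight is at least 1/B. Together
  with an initial spread of at most \<open>card S * M\<^sup>2\<close> this produces the factor sqrt
  (B * card S).\<close>

lemma steps_contract:
  fixes B \<gamma> M :: real
  assumes U: "admissible B U" and \<gamma>: "2 * exp 4 * d\<^sup>2 * A * B * \<gamma> \<le> 1" "\<gamma> > 0"
    and M: "\<And>x. x \<in> S \<Longrightarrow> \<bar>f x\<bar> \<le> M" and x: "x \<in> S"
  shows "\<bar>(step U ^^ s) f x - gibbs U f\<bar> \<le> sqrt (B * card S) * M * exp (- (\<gamma> / 2 * s))"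
proof -
  note B = admissible_pos[OF U]
  have "M \<ge> 0" using M[OF x] by simp
  have spread_s: "spread U ((step U ^^ s) f) \<le> exp (- \<gamma> * s) * spread U f"
  proof (induction s)
    case (Suc s)
    have "spread U ((step U ^^ Suc s) f) \<le> (1 - \<gamma>) * spread U ((step U ^^ s) f)"
      using spread_step[OF U \<gamma>] by simp
    also have "\<dots> \<le> exp (- \<gamma>) * spread U ((step U ^^ s) f)"
      using exp_ge_add_one_self[of "- \<gamma>"] by (intro mult_right_mono spread_nonneg) simp
    also have "\<dots> \<le> exp (- \<gamma>) * (exp (- \<gamma> * s) * spread U f)"
      by (intro mult_left_mono Suc.IH) simp
    finally show ?case
      by (simp add: distrib_left exp_add exp_diff exp_minus mult_ac divide_inverse)
  qed simp
  have "spread U f \<le> (\<Sum>x\<in>S. exp (- U x) * (f x - 0)\<^sup>2)"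
    by (rule spread_le)
  also have "\<dots> \<le> (\<Sum>x\<in>S. 1 * M\<^sup>2)"
    using U M \<open>M \<ge> 0\<close> by (intro sum_mono mult_mono) (auto simp: admissible_def power2_le_iff_abs_le)
  finally have spread_f: "spread U f \<le> card S * M\<^sup>2" by simp
  define v where "v = (step U ^^ s) f x - gibbs U f"
  have "1 / B \<le> exp (- U x)"
    using U x B by (auto simp: admissible_def exp_minus field_simps)
  then have "1 / B * v\<^sup>2 \<le> exp (- U x) * v\<^sup>2"
    by (intro mult_right_mono) auto
  also have "\<dots> \<le> spread U ((step U ^^ s) f)"
    unfolding spread_def v_def gibbs_steps
    using x finite_S by (intro member_le_sum[where f = "\<lambda>x. exp (- U x) * ((step U ^^ s) f x - gibbs U f)\<^sup>2"]) auto
  also have "\<dots> \<le> exp (- \<gamma> * s) * (card S * M\<^sup>2)"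
    by (rule order_trans[OF spread_s mult_left_mono[OF spread_f]]) simp
  finally have "v\<^sup>2 \<le> B * (exp (- \<gamma> * s) * (card S * M\<^sup>2))"
    using B by (simp add: field_simps)
  also have "\<dots> = (sqrt (B * card S) * M * exp (- (\<gamma> / 2 * s)))\<^sup>2"
    using B by (simp add: power_mult_distrib flip: exp_of_nat_mult)
  finally show ?thesis
    unfolding v_def[symmetric] by (rule power2_le_iff_abs_le[THEN iffD1, rotated]) (use B \<open>M \<ge> 0\<close> in auto)
qed

section \<open>Sensitivity to the energy function\<close>

definition close :: "real \<Rightarrow> ('a \<Rightarrow> real) \<Rightarrow> ('a \<Rightarrow> real) \<Rightarrow> bool" where
  "close \<delta> U U' \<longleftrightarrow> (\<forall>x\<in>S. \<forall>y\<in>N x. \<bar>(U y - U x) - (U' y - U' x)\<bar> \<le> \<delta>)"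

text \<open>Only energy differences along moves enter the acceptance rule, which is why
  \<open>close\<close> compares just these. As a function of such a difference the acceptance
  probability is 1-Lipschitz.\<close>

lemma step_perturb:
  assumes "close \<delta> U U'" and M: "\<And>x. x \<in> S \<Longrightarrow> \<bar>f x\<bar> \<le> M" and x: "x \<in> S"
  shows "\<bar>step U f x - step U' f x\<bar> \<le> 2 * \<delta> * M"
proof -
  have lip: "\<bar>exp (- u) - exp (- v)\<bar> \<le> \<bar>u - v\<bar>" if "u \<ge> 0" "v \<ge> 0" for u v :: real
  proof -
    have *: "exp (- u) - exp (- v) \<le> v - u" if "0 \<le> u" "u \<le> v" for u v :: real
    proof -
      have "exp (- u) - exp (- v) = exp (- u) * (1 - exp (- (v - u)))"
        by (simp add: algebra_simps flip: exp_add)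
      also have "\<dots> \<le> 1 * (v - u)"
      proof (rule mult_mono)
        show "1 - exp (- (v - u)) \<le> v - u"
          using exp_ge_add_one_self[of "- (v - u)"] by linarith
      qed (use that in auto)
      finally show ?thesis by simp
    qed
    show ?thesis
      using *[of u v] *[of v u] that by (cases u v rule: linorder_cases) auto
  qed
  have "\<bar>\<Sum>y\<in>N x. (acc U x y - acc U' x y) * (f y - f x)\<bar> \<le> (\<Sum>y\<in>N x. \<delta> * (2 * M))"
  proof (rule order_trans[OF sum_abs sum_mono])
    fix y assume y: "y \<in> N x"
    then have "y \<in> S" using x N_subset by auto
    have "\<bar>acc U x y - acc U' x y\<bar> \<le> \<bar>max 0 (U y - U x) - max 0 (U' y - U' x)\<bar>"
      unfolding acc_def by (rule lip) auto
    also have "\<dots> \<le> \<delta>"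
      using assms(1) x y by (fastforce simp: close_def max_def)
    finally have "\<bar>acc U x y - acc U' x y\<bar> \<le> \<delta>" .
    moreover have "\<bar>f y - f x\<bar> \<le> 2 * M"
      using M[OF x] M[OF \<open>y \<in> S\<close>] by linarith
    ultimately show "\<bar>(acc U x y - acc U' x y) * (f y - f x)\<bar> \<le> \<delta> * (2 * M)"
      unfolding abs_mult by (intro mult_mono) auto
  qed
  moreover have "step U f x - step U' f x = (\<Sum>y\<in>N x. (acc U x y - acc U' x y) * (f y - f x)) / d"
    by (simp add: step_def left_diff_distrib sum_subtractf diff_divide_distrib)
  ultimately show ?thesis
    using card_N[OF x] d_pos by (simp add: pos_divide_le_eq mult_ac)
qed

text \<open>Both chains fix constants, so \<^term>\<open>f\<close> may be centred before comparing one step.\<close>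

lemma step_perturb_centred:
  assumes "close \<delta> U U'" and M: "\<And>x. x \<in> S \<Longrightarrow> \<bar>f x - c\<bar> \<le> M" and x: "x \<in> S"
  shows "\<bar>step U f x - step U' f x\<bar> \<le> 2 * \<delta> * M"
  using step_perturb[OF assms] by (simp add: step_diff step_const)

context
  fixes B \<gamma> \<delta> C :: real
  assumes \<gamma>: "2 * exp 4 * d\<^sup>2 * A * B * \<gamma> \<le> 1" "\<gamma> > 0" and \<delta>: "\<delta> \<ge> 0"
  defines "C \<equiv> sqrt (B * card S)"
begin

lemma geometric_bound: "(\<Sum>j<s. exp (- (\<gamma> / 2 * real j))) \<le> 1 + 2 / \<gamma>"
proof -
  define r where "r = exp (- (\<gamma> / 2))"
  have r: "0 < r" "r < 1" using \<gamma> by (auto simp: r_def)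
  have "(\<Sum>j<s. exp (- (\<gamma> / 2 * real j))) = (\<Sum>j<s. r ^ j)"
    unfolding r_def by (intro sum.cong refl) (simp add: mult_ac flip: exp_of_nat_mult)
  also have "\<dots> = (1 - r ^ s) / (1 - r)"
    using r by (simp add: sum_gp_strict)
  also have "\<dots> \<le> 1 / (1 - r)"
    using r by (intro divide_right_mono) auto
  also have "\<dots> \<le> 1 + 2 / \<gamma>"
  proof -
    have "1 + \<gamma> / 2 \<le> 1 / r"
      using exp_ge_add_one_self[of "\<gamma> / 2"] by (simp add: r_def exp_minus inverse_eq_divide)
    then have "(1 + \<gamma> / 2) * r \<le> 1" using r by (simp add: field_simps)
    then show ?thesis using r \<gamma> by (simp add: field_simps)
  qed
  finally show ?thesis .
qed

context
  fixes U U' :: "'a \<Rightarrow> real"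
  assumes U: "admissible B U" and U': "admissible B U'" and UU': "close \<delta> U U'"
begin

lemma C_nonneg: "C \<ge> 0"
  using admissible_pos[OF U] by (simp add: C_def)

text \<open>The \<open>s\<close> steps with \<open>U'\<close> have already flattened
  \<open>f\<close> to a constant up to an exponentially small remainder, and both operators agree on
  constants.\<close>

lemma steps_perturb_step:
  assumes M: "\<And>x. x \<in> S \<Longrightarrow> \<bar>f x\<bar> \<le> M" and x: "x \<in> S"
  shows "\<bar>step U ((step U' ^^ s) f) x - step U' ((step U' ^^ s) f) x\<bar>
    \<le> 2 * \<delta> * C * M * exp (- (\<gamma> / 2 * s))"
proof -
  have "\<bar>step U ((step U' ^^ s) f) x - step U' ((step U' ^^ s) f) x\<bar>
      \<le> 2 * \<delta> * (C * M * exp (- (\<gamma> / 2 * s)))"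
    unfolding C_def
    by (rule step_perturb_centred[OF UU' steps_contract[OF U' \<gamma>]]) (use M x in auto)
  then show ?thesis by (simp add: mult_ac)
qed

text \<open>Telescoping over the step at which \<open>U'\<close> is replaced by \<open>U\<close>.
  The discrepancies decay geometrically, so the bound is uniform in \<open>s\<close>, which permits
  the limit in \<open>gibbs_perturb\<close>.\<close>

lemma steps_perturb:
  assumes M: "\<And>x. x \<in> S \<Longrightarrow> \<bar>f x\<bar> \<le> M" and x: "x \<in> S"
  shows "\<bar>(step U ^^ s) f x - (step U' ^^ s) f x\<bar> \<le> 2 * \<delta> * C * M * (1 + 2 / \<gamma>)"
proof -
  have "\<bar>(step U ^^ s) f x - (step U' ^^ s) f x\<bar>
      \<le> 2 * \<delta> * C * M * (\<Sum>j<s. exp (- (\<gamma> / 2 * real j)))"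
    using x
  proof (induction s arbitrary: x)
    case (Suc s)
    define \<Phi> where "\<Phi> = (\<lambda>x. (step U ^^ s) f x - (step U' ^^ s) f x)"
    have "\<bar>step U \<Phi> x\<bar> \<le> 2 * \<delta> * C * M * (\<Sum>j<s. exp (- (\<gamma> / 2 * real j)))"
      unfolding \<Phi>_def by (rule step_bound[OF Suc.IH Suc.prems])
    moreover have "(step U ^^ Suc s) f x - (step U' ^^ Suc s) f x
        = step U \<Phi> x + (step U ((step U' ^^ s) f) x - step U' ((step U' ^^ s) f) x)"
      by (simp add: \<Phi>_def step_diff)
    ultimately show ?case
      using steps_perturb_step[of f M, OF M Suc.prems, of s] by (simp add: algebra_simps)
  qed simp
  also have "\<dots> \<le> 2 * \<delta> * C * M * (1 + 2 / \<gamma>)"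
    using M[OF x] C_nonneg \<delta> by (intro mult_left_mono geometric_bound) auto
  finally show ?thesis .
qed

text \<open>A discrepancy born after j steps carries the factor exp (- \<gamma>/2 * j) and is then
  contracted during all remaining steps. So each of the \<open>s\<close> contributions has the full
  exponent, short of the one step at which the operators are exchanged. The two flattenings give
  C^2; the extra \<open>i\<close> steps keep the claim inductive.\<close>

lemma steps_perturb_centred:
  assumes M: "\<And>x. x \<in> S \<Longrightarrow> \<bar>f x\<bar> \<le> M" and x: "x \<in> S"
  defines "\<Phi> \<equiv> \<lambda>s x. (step U ^^ s) f x - (step U' ^^ s) f x"
  shows "\<bar>(step U ^^ i) (\<Phi> s) x - gibbs U (\<Phi> s)\<bar>
    \<le> real s * (2 * \<delta> * C\<^sup>2 * M) * exp (- (\<gamma> / 2 * (real s + real i - 1)))"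
proof (induction s arbitrary: i)
  case 0
  then show ?case by (simp add: \<Phi>_def steps_const gibbs_const)
next
  case (Suc s)
  define g where "g = (\<lambda>x. step U ((step U' ^^ s) f) x - step U' ((step U' ^^ s) f) x)"
  have \<Phi>_Suc: "\<Phi> (Suc s) = (\<lambda>x. step U (\<Phi> s) x + g x)"
    by (simp add: \<Phi>_def g_def step_diff)
  have steps_add: "(step U ^^ i) (\<lambda>x. u x + g x) = (\<lambda>x. (step U ^^ i) u x + (step U ^^ i) g x)" for u
    by (induction i) (simp_all add: step_add)
  have g: "\<bar>g y\<bar> \<le> 2 * \<delta> * C * M * exp (- (\<gamma> / 2 * s))" if "y \<in> S" for y
    unfolding g_def by (rule steps_perturb_step[OF M that])
  have "\<bar>(step U ^^ i) g x - gibbs U g\<bar>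
      \<le> C * (2 * \<delta> * C * M * exp (- (\<gamma> / 2 * s))) * exp (- (\<gamma> / 2 * i))"
    unfolding C_def by (rule steps_contract[OF U \<gamma> g[unfolded C_def] x])
  also have "\<dots> = 2 * \<delta> * C\<^sup>2 * M * exp (- (\<gamma> / 2 * (real (Suc s) + real i - 1)))"
    by (simp add: power2_eq_square algebra_simps flip: exp_add)
  finally have 1: "\<bar>(step U ^^ i) g x - gibbs U g\<bar>
      \<le> 2 * \<delta> * C\<^sup>2 * M * exp (- (\<gamma> / 2 * (real (Suc s) + real i - 1)))" .
  have 2: "\<bar>(step U ^^ Suc i) (\<Phi> s) x - gibbs U (\<Phi> s)\<bar>
      \<le> real s * (2 * \<delta> * C\<^sup>2 * M) * exp (- (\<gamma> / 2 * (real (Suc s) + real i - 1)))"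
    using Suc.IH[of "Suc i"] by (simp add: algebra_simps)
  have "(step U ^^ i) (\<Phi> (Suc s)) x - gibbs U (\<Phi> (Suc s))
      = ((step U ^^ Suc i) (\<Phi> s) x - gibbs U (\<Phi> s)) + ((step U ^^ i) g x - gibbs U g)"
    by (simp add: \<Phi>_Suc steps_add gibbs_add gibbs_step funpow_swap1)
  then show ?case
    using 1 2 by (simp add: algebra_simps)
qed

text \<open>The Gibbs mean is the limit of the chain from any starting state, so the bound for
  finitely many steps passes to it.\<close>

lemma gibbs_perturb:
  assumes M: "\<And>x. x \<in> S \<Longrightarrow> \<bar>f x\<bar> \<le> M"
  shows "\<bar>gibbs U f - gibbs U' f\<bar> \<le> 2 * \<delta> * C * M * (1 + 2 / \<gamma>)"
proof -
  obtain x where x: "x \<in> S" using S_nonempty by auto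
  have lim: "(\<lambda>s. (step V ^^ s) f x) \<longlonglongrightarrow> gibbs V f" if V: "admissible B V" for V
  proof (rule Lim_null[THEN iffD2], rule Lim_null_comparison)
    show "\<forall>\<^sub>F s in sequentially. norm ((step V ^^ s) f x - gibbs V f)
        \<le> sqrt (B * card S) * M * exp (- (\<gamma> / 2 * real s))"
      using steps_contract[OF V \<gamma> M x] by simp
    show "(\<lambda>s. sqrt (B * card S) * M * exp (- (\<gamma> / 2 * real s))) \<longlonglongrightarrow> 0"
      using \<gamma>(2) by real_asymp
  qed
  show ?thesis
    using tendsto_rabs[OF tendsto_diff[OF lim[OF U] lim[OF U']]]
    by (rule LIMSEQ_le_const2) (use steps_perturb[OF M x] in auto)
qed

end

end

section \<open>Concatenation of epochs\<close>

primrec run :: "(nat \<Rightarrow> 'a \<Rightarrow> real) \<Rightarrow> (nat \<Rightarrow> nat) \<Rightarrow> nat \<Rightarrow> ('a \<Rightarrow> real) \<Rightarrow> 'a \<Rightarrow> real" where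
  "run U m 0 f = f"
| "run U m (Suc k) f = run U m k ((step (U (Suc k)) ^^ m (Suc k)) f)"

lemma run_diff: "run U m k (\<lambda>x. f x - g x) = (\<lambda>x. run U m k f x - run U m k g x)"
  by (induction k arbitrary: f g) (simp_all add: steps_diff)

lemma run_const: "run U m k (\<lambda>_. c) = (\<lambda>_. c)"
  by (induction k) (simp_all add: steps_const)

lemma run_bound:
  assumes "\<And>x. x \<in> S \<Longrightarrow> \<bar>f x\<bar> \<le> M" and "x \<in> S"
  shows "\<bar>run U m k f x\<bar> \<le> M"
  using assms by (induction k arbitrary: f) (simp_all add: steps_bound)

text \<open>The energies are exchanged one epoch at a time at equal cost; the surrounding epochs do
  no harm because they never increase a supremum bound.\<close>

lemma run_perturb:
  fixes B \<gamma> \<delta> M :: real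
  assumes \<gamma>: "2 * exp 4 * d\<^sup>2 * A * B * \<gamma> \<le> 1" "\<gamma> > 0" and \<delta>: "\<delta> \<ge> 0"
    and U: "\<And>j. j \<in> {1..k} \<Longrightarrow> admissible B (U j)" "\<And>j. j \<in> {1..k} \<Longrightarrow> admissible B (U' j)"
      "\<And>j. j \<in> {1..k} \<Longrightarrow> close \<delta> (U j) (U' j)"
    and M: "\<And>x. x \<in> S \<Longrightarrow> \<bar>f x\<bar> \<le> M" and x: "x \<in> S"
  shows "\<bar>run U m k f x - run U' m k f x\<bar>
    \<le> k * (2 * \<delta> * sqrt (B * card S) * M * (1 + 2 / \<gamma>))"
  using U M
proof (induction k arbitrary: f)
  case (Suc k)
  define F where "F = (step (U (Suc k)) ^^ m (Suc k)) f"
  define F' where "F' = (step (U' (Suc k)) ^^ m (Suc k)) f"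
  have "\<bar>run U m k F x - run U' m k F x\<bar> \<le> k * (2 * \<delta> * sqrt (B * card S) * M * (1 + 2 / \<gamma>))"
    unfolding F_def by (rule Suc.IH) (use Suc.prems in \<open>auto intro: steps_bound\<close>)
  moreover have "\<bar>run U' m k (\<lambda>x. F x - F' x) x\<bar> \<le> 2 * \<delta> * sqrt (B * card S) * M * (1 + 2 / \<gamma>)"
    unfolding F_def F'_def
    by (intro run_bound steps_perturb[OF \<gamma> \<delta>] Suc.prems x) auto
  moreover have "run U m (Suc k) f x - run U' m (Suc k) f x
      = (run U m k F x - run U' m k F x) + run U' m k (\<lambda>x. F x - F' x) x"
    by (simp add: F_def F'_def run_diff)
  ultimately show ?case
    unfolding of_nat_Suc distrib_right by linarith
qed simp

text \<open>The last epoch alone brings \<open>f\<close> close to a constant; the earlier ones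
  merely average what is left.\<close>

lemma run_error:
  fixes B \<gamma> M :: real
  assumes \<gamma>: "2 * exp 4 * d\<^sup>2 * A * B * \<gamma> \<le> 1" "\<gamma> > 0"
    and U: "admissible B (U (Suc k))"
    and M: "\<And>x. x \<in> S \<Longrightarrow> \<bar>f x\<bar> \<le> M" and x: "x \<in> S"
  shows "\<bar>run U m (Suc k) f x - gibbs (U (Suc k)) f\<bar>
    \<le> sqrt (B * card S) * M * exp (- (\<gamma> / 2 * m (Suc k)))"
proof -
  have "run U m (Suc k) f x - gibbs (U (Suc k)) f
      = run U m k (\<lambda>x. (step (U (Suc k)) ^^ m (Suc k)) f x - gibbs (U (Suc k)) f) x"
    by (simp add: run_diff run_const)
  also have "\<bar>\<dots>\<bar> \<le> sqrt (B * card S) * M * exp (- (\<gamma> / 2 * m (Suc k)))"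
    by (rule run_bound[OF steps_contract[OF U \<gamma> M] x])
  finally show ?thesis .
qed

text \<open>The bound must be small in \<delta> and in the length of the last epoch at once.
  Therefore constants are subtracted right after the last epoch, before the perturbation bounds are
  applied.\<close>

lemma run_error_perturb:
  fixes B \<gamma> \<delta> M :: real
  assumes \<gamma>: "2 * exp 4 * d\<^sup>2 * A * B * \<gamma> \<le> 1" "\<gamma> > 0" and \<delta>: "\<delta> \<ge> 0"
    and U: "\<And>j. j \<in> {1..Suc k} \<Longrightarrow> admissible B (U j)" "\<And>j. j \<in> {1..Suc k} \<Longrightarrow> admissible B (U' j)"
      "\<And>j. j \<in> {1..Suc k} \<Longrightarrow> close \<delta> (U j) (U' j)"
    and M: "\<And>x. x \<in> S \<Longrightarrow> \<bar>f x\<bar> \<le> M" and x: "x \<in> S"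
  shows "\<bar>(run U m (Suc k) f x - gibbs (U (Suc k)) f) - (run U' m (Suc k) f x - gibbs (U' (Suc k)) f)\<bar>
    \<le> \<delta> * (B * card S) * M * exp (- (\<gamma> / 2 * m (Suc k)))
        * (2 * real (m (Suc k)) * exp (\<gamma> / 2) + 2 * real (Suc k) * (1 + 2 / \<gamma>))"
proof -
  let ?U = "U (Suc k)" and ?U' = "U' (Suc k)"
  define s where "s = m (Suc k)"
  define C where "C = sqrt (B * card S)"
  define F where "F = (step ?U ^^ s) f"
  define F' where "F' = (step ?U' ^^ s) f"
  define h where "h = (\<lambda>x. F' x - gibbs ?U' f)"
  define M' where "M' = C * M * exp (- (\<gamma> / 2 * s))"
  have V: "admissible B ?U" "admissible B ?U'" "close \<delta> ?U ?U'"
    using U by auto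
  have C2: "C\<^sup>2 = B * card S"
    using admissible_pos[OF V(1)] by (simp add: C_def)
  have h: "\<bar>h y\<bar> \<le> M'" if "y \<in> S" for y
    unfolding h_def F'_def M'_def C_def by (rule steps_contract[OF V(2) \<gamma> M that])
  have 1: "\<bar>run U m k (\<lambda>x. (F x - F' x) - gibbs ?U (\<lambda>x. F x - F' x)) x\<bar>
      \<le> real s * (2 * \<delta> * C\<^sup>2 * M) * exp (- (\<gamma> / 2 * (real s + real 0 - 1)))"
    using steps_perturb_centred[OF \<gamma> \<delta> V M, where i = 0 and s = s]
    unfolding F_def F'_def C_def by (intro run_bound x) auto
  have 2: "\<bar>run U m k h x - run U' m k h x\<bar> \<le> k * (2 * \<delta> * C * M' * (1 + 2 / \<gamma>))"
    unfolding C_def by (rule run_perturb[OF \<gamma> \<delta> _ _ _ h x]) (use U in auto)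
  have 3: "\<bar>gibbs ?U h - gibbs ?U' h\<bar> \<le> 2 * \<delta> * C * M' * (1 + 2 / \<gamma>)"
    unfolding C_def by (rule gibbs_perturb[OF \<gamma> \<delta> V h])
  \<comment> \<open>The first term changes the energy of the last epoch only. The other two change
    it in the earlier epochs and in the Gibbs mean, but they act on \<open>h\<close>, which is
    already of size \<open>M'\<close>; together they amount to \<open>Suc k\<close> equal
    bounds.\<close>
  have "(run U m (Suc k) f x - gibbs ?U f) - (run U' m (Suc k) f x - gibbs ?U' f)
      = run U m k (\<lambda>x. (F x - F' x) - gibbs ?U (\<lambda>x. F x - F' x)) x
        + (run U m k h x - run U' m k h x) - (gibbs ?U h - gibbs ?U' h)"
    by (simp add: run_diff run_const gibbs_diff gibbs_const gibbs_steps h_def F_def F'_def s_def)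
  then have "\<bar>(run U m (Suc k) f x - gibbs ?U f) - (run U' m (Suc k) f x - gibbs ?U' f)\<bar>
      \<le> real s * (2 * \<delta> * C\<^sup>2 * M) * exp (- (\<gamma> / 2 * (real s + real 0 - 1)))
        + Suc k * (2 * \<delta> * C * M' * (1 + 2 / \<gamma>))"
    using 1 2 3 unfolding of_nat_Suc distrib_right by linarith
  also have "\<dots> = \<delta> * C\<^sup>2 * M * exp (- (\<gamma> / 2 * s)) * (2 * real s * exp (\<gamma> / 2) + 2 * real (Suc k) * (1 + 2 / \<gamma>))"
  proof -
    have "exp (- (\<gamma> / 2 * (real s + real 0 - 1))) = exp (- (\<gamma> / 2 * s)) * exp (\<gamma> / 2)"
      by (simp add: field_simps flip: exp_add)
    then show ?thesis
      by (simp add: M'_def power2_eq_square algebra_simps add_divide_distrib)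
  qed
  finally show ?thesis
    unfolding C2 s_def .
qed


section \<open>Monotonicity in a single edge weight\<close>

lemma gibbs_indicator_increment:
  fixes T :: "'a \<Rightarrow> bool" and R :: "'a \<Rightarrow> real" and u u' B :: real
  assumes B: "\<And>x. x \<in> S \<Longrightarrow> 0 \<le> R x \<and> exp (R x) \<le> B"
    and u: "0 \<le> u'" "u' \<le> u" "u \<le> 1" and T: "\<exists>x\<in>S. T x"
  defines "f \<equiv> \<lambda>x. of_bool (T x)"
  shows "exp u * gibbs (\<lambda>x. R x + u * f x) f - exp u' * gibbs (\<lambda>x. R x + u' * f x) f
    \<ge> exp (- 1) * (u - u') / (B * card S)\<^sup>2"
proof -
  define P where "P = (\<Sum>x\<in>S. exp (- R x) * f x)"
  define Q where "Q = (\<Sum>x\<in>S. exp (- R x) * (1 - f x))"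
  obtain x where x: "x \<in> S" "T x" using T by auto
  have "B > 0" using B[OF x(1)] by (metis exp_gt_zero less_le_trans)
  have card: "real (card S) > 0" using finite_S S_nonempty by (simp add: card_gt_0_iff)
  have "1 / B \<le> exp (- R x)"
    using B[OF x(1)] \<open>B > 0\<close> by (simp add: exp_minus field_simps)
  also have "\<dots> \<le> P"
    using x member_le_sum[of x S "\<lambda>x. exp (- R x) * f x"] finite_S by (simp add: P_def f_def)
  finally have P: "1 / B \<le> P" .
  then have "P > 0" using \<open>B > 0\<close> by (meson divide_pos_pos less_le_trans zero_less_one)
  have Q: "Q \<ge> 0" unfolding Q_def f_def by (intro sum_nonneg) auto
  have "P + Q = (\<Sum>x\<in>S. exp (- R x))"
    by (simp add: P_def Q_def algebra_simps flip: sum.distrib)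
  also have "\<dots> \<le> (\<Sum>x\<in>S. 1)"
    using B by (intro sum_mono) auto
  finally have PQ: "P + Q \<le> card S" by simp
  have gibbs: "exp v * gibbs (\<lambda>x. R x + v * f x) f = P / (P * exp (- v) + Q)" for v
  proof -
    have "(\<Sum>x\<in>S. exp (- (R x + v * f x)) * f x) = exp (- v) * P"
      unfolding P_def sum_distrib_left f_def by (intro sum.cong refl) (simp add: exp_add exp_diff exp_minus field_simps)
    moreover have "(\<Sum>x\<in>S. exp (- (R x + v * f x))) = P * exp (- v) + Q"
      unfolding P_def Q_def sum_distrib_right sum.distrib[symmetric] f_def
      by (intro sum.cong refl) (simp add: exp_add exp_diff exp_minus field_simps)
    ultimately show ?thesis
      by (simp add: gibbs_def exp_minus)
  qed
  define D where "D v = P * exp (- v) + Q" for v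
  have D: "0 < D v" "D v \<le> card S" if "v \<ge> 0" for v
  proof -
    have "P * exp (- v) \<le> P * 1"
      using \<open>P > 0\<close> that by (intro mult_left_mono) auto
    then show "D v \<le> card S" using PQ by (simp add: D_def)
    show "0 < D v" using \<open>P > 0\<close> Q by (simp add: D_def add_pos_nonneg)
  qed
  have "exp (- 1) * (u - u') \<le> exp (- u) * (exp (u - u') - 1)"
    using u exp_ge_add_one_self[of "u - u'"] by (intro mult_mono) (auto simp del: exp_ge_add_one_self)
  also have "\<dots> = exp (- u') - exp (- u)"
    by (simp add: right_diff_distrib flip: exp_add)
  finally have inc: "exp (- 1) * (u - u') \<le> exp (- u') - exp (- u)" .
  \<comment> \<open>The difference of the quotients has numerator \<open>P\<^sup>2\<close> times the
    difference of the exponentials. Here \<open>P\<close> is at least 1/B because some state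
    satisfies \<open>T\<close>, and both denominators are at most \<open>card S\<close>.\<close>
  have "exp (- 1) * (u - u') / (B * card S)\<^sup>2 = (1 / B)\<^sup>2 * (exp (- 1) * (u - u')) / (card S * card S)"
    by (simp add: power2_eq_square field_simps)
  also have "\<dots> \<le> P\<^sup>2 * (exp (- u') - exp (- u)) / (D u * D u')"
    using D u P \<open>P > 0\<close> \<open>B > 0\<close> inc mult_mono[OF D(2)[of u] D(2)[of u']]
    by (intro frac_le mult_right_mono mult_mono[of "(1 / B)\<^sup>2"] power_mono mult_nonneg_nonneg mult_pos_pos) (auto intro: less_imp_le)
  also have "\<dots> = P / D u - P / D u'"
    using D[of u] D[of u'] u by (simp add: field_simps power2_eq_square) (simp add: D_def algebra_simps)
  finally show ?thesis
    unfolding gibbs D_def .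
qed

text \<open>The error contributes exp u * \<epsilon> - exp u' * \<epsilon>' = exp u * (\<epsilon> -
  \<epsilon>') + (exp u - exp u') * \<epsilon>'. Each part is at most exp 1 * \<eta> * (u - u') in
  absolute value, so \<open>small\<close> says 2 * exp 1 * \<eta> \<le> exp (-1) / (B * card S)^2,
  which lets the Gibbs increment win.\<close>

lemma exp_run_indicator_mono:
  fixes T :: "'a \<Rightarrow> bool" and R :: "'a \<Rightarrow> real" and u u' B \<gamma> :: real
  assumes \<gamma>: "2 * exp 4 * d\<^sup>2 * A * B * \<gamma> \<le> 1" "\<gamma> > 0"
    and U: "\<And>j. j \<in> {1..Suc k} \<Longrightarrow> admissible B (U j)" "\<And>j. j \<in> {1..Suc k} \<Longrightarrow> admissible B (U' j)"
      "\<And>j. j \<in> {1..Suc k} \<Longrightarrow> close (u - u') (U j) (U' j)"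
    and R: "\<And>x. x \<in> S \<Longrightarrow> 0 \<le> R x"
    and u: "0 \<le> u'" "u' \<le> u" "u \<le> 1"
  defines "f \<equiv> \<lambda>x. of_bool (T x)"
  assumes UR: "\<And>x. x \<in> S \<Longrightarrow> U (Suc k) x = R x + u * f x"
      "\<And>x. x \<in> S \<Longrightarrow> U' (Suc k) x = R x + u' * f x"
    and small: "2 * exp 2 * (B * card S) ^ 3 * exp (- (\<gamma> / 2 * m (Suc k)))
        * (2 * real (m (Suc k)) * exp (\<gamma> / 2) + 2 * real (Suc k) * (1 + 2 / \<gamma>)) \<le> 1"
    and x: "x \<in> S"
  shows "exp u' * run U' m (Suc k) f x \<le> exp u * run U m (Suc k) f x"
proof (cases "\<exists>x\<in>S. T x")
  \<comment> \<open>Without a state satisfying \<open>T\<close> the observable vanishes on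
    \<open>S\<close>, so both sides are 0.\<close>
  case False
  then have "\<bar>run V m (Suc k) f x\<bar> \<le> 0" for V
    by (intro run_bound x) (auto simp: f_def)
  then show ?thesis by simp
next
  case True
  let ?U = "U (Suc k)" and ?U' = "U' (Suc k)"
  define b where "b = B * card S"
  define L where "L = 2 * real (m (Suc k)) * exp (\<gamma> / 2) + 2 * real (Suc k) * (1 + 2 / \<gamma>)"
  \<comment> \<open>One quantity dominates both the change of the error per unit of \<open>u\<close>
    and the error itself; the latter by \<open>sqrt b \<le> b\<close> and
    \<open>1 \<le> L\<close>.\<close>
  define \<eta> where "\<eta> = b * exp (- (\<gamma> / 2 * m (Suc k))) * L"
  define \<epsilon> where "\<epsilon> = run U m (Suc k) f x - gibbs ?U f"
  define \<epsilon>' where "\<epsilon>' = run U' m (Suc k) f x - gibbs ?U' f"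
  have V: "admissible B ?U" "admissible B ?U'" using U by auto
  have "1 \<le> exp (?U x)" "exp (?U x) \<le> B"
    using V(1) x by (auto simp: admissible_def)
  then have "1 \<le> B" by linarith
  moreover have "1 \<le> real (card S)"
    using finite_S S_nonempty by (simp add: Suc_le_eq card_gt_0_iff)
  ultimately have b: "1 \<le> b"
    using mult_mono[of 1 B 1 "real (card S)"] by (simp add: b_def)
  have L: "1 \<le> L"
  proof -
    have "1 * 1 \<le> (2 * real (Suc k)) * (1 + 2 / \<gamma>)"
      using \<gamma> by (intro mult_mono) auto
    then show ?thesis
      unfolding L_def by (simp add: add_increasing)
  qed
  then have "\<eta> \<ge> 0" using b by (simp add: \<eta>_def)
  have f: "\<bar>f y\<bar> \<le> 1" for y by (simp add: f_def)
  have d: "\<bar>\<epsilon> - \<epsilon>'\<bar> \<le> (u - u') * \<eta>"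
    using run_error_perturb[where \<delta> = "u - u'" and m = m and M = 1, OF \<gamma> _ U f x] u
    unfolding \<epsilon>_def \<epsilon>'_def \<eta>_def L_def b_def by (simp add: mult_ac)
  have e': "\<bar>\<epsilon>'\<bar> \<le> \<eta>"
  proof -
    have "sqrt b \<le> b" using b by (simp add: real_sqrt_le_iff' real_le_lsqrt self_le_power power2_eq_square)
    then have "(sqrt b * 1 * exp (- (\<gamma> / 2 * m (Suc k)))) * 1 \<le> (b * exp (- (\<gamma> / 2 * m (Suc k)))) * L"
      using L b by (intro mult_mono) auto
    then have "sqrt b * 1 * exp (- (\<gamma> / 2 * m (Suc k))) \<le> \<eta>"
      unfolding \<eta>_def by (simp only: mult_1_right)
    then show ?thesis
      unfolding \<epsilon>'_def b_def
      by (rule order_trans[OF run_error[where U = U' and f = f and m = m and k = k and M = 1, OF \<gamma> V(2) f x]])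
  qed
  have expd: "exp u - exp u' \<le> exp 1 * (u - u')"
  proof -
    have "exp u - exp u' = exp u * (1 - exp (u' - u))"
      by (simp add: right_diff_distrib flip: exp_add)
    also have "\<dots> \<le> exp 1 * (u - u')"
    proof (rule mult_mono)
      show "1 - exp (u' - u) \<le> u - u'"
        using exp_ge_add_one_self[of "u' - u"] by linarith
    qed (use u in auto)
    finally show ?thesis .
  qed
  have "- (exp 1 * ((u - u') * \<eta>)) \<le> exp u * (\<epsilon> - \<epsilon>')"
  proof -
    have "\<bar>exp u * (\<epsilon> - \<epsilon>')\<bar> \<le> exp 1 * ((u - u') * \<eta>)"
      unfolding abs_mult using d u by (intro mult_mono) auto
    then show ?thesis by linarith
  qed
  moreover have "- (exp 1 * (u - u') * \<eta>) \<le> (exp u - exp u') * \<epsilon>'"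
  proof -
    have "\<bar>(exp u - exp u') * \<epsilon>'\<bar> \<le> exp 1 * (u - u') * \<eta>"
      unfolding abs_mult using e' u expd \<open>\<eta> \<ge> 0\<close> by (intro mult_mono) auto
    then show ?thesis by linarith
  qed
  ultimately have err: "- (2 * exp 1 * \<eta> * (u - u')) \<le> exp u * \<epsilon> - exp u' * \<epsilon>'"
    by (simp add: algebra_simps)
  have "2 * exp 1 * \<eta> \<le> exp (- 1) / b\<^sup>2"
  proof -
    have "2 * exp 1 * \<eta> * exp 1 * b\<^sup>2 \<le> 1"
    proof -
      have "exp 2 = exp 1 * exp (1 :: real)" by (simp flip: exp_add)
      then show ?thesis
        using small unfolding \<eta>_def L_def b_def
        by (simp add: power2_eq_square power3_eq_cube mult_ac)
    qed
    then show ?thesis using b by (simp add: exp_minus field_simps)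
  qed
  then have "2 * exp 1 * \<eta> * (u - u') \<le> exp (- 1) / b\<^sup>2 * (u - u')"
    using u by (intro mult_right_mono) auto
  also have "\<dots> \<le> exp u * gibbs ?U f - exp u' * gibbs ?U' f"
  proof -
    have "0 \<le> R y \<and> exp (R y) \<le> B" if "y \<in> S" for y
    proof -
      have "R y \<le> ?U y" using UR(1)[OF that] u by (simp add: f_def)
      then have "exp (R y) \<le> exp (?U y)" by simp
      moreover have "exp (?U y) \<le> B"
        using V(1) that by (simp add: admissible_def)
      ultimately show ?thesis using R[OF that] by (intro conjI) linarith+
    qed
    moreover have "gibbs ?U f = gibbs (\<lambda>x. R x + u * f x) f" "gibbs ?U' f = gibbs (\<lambda>x. R x + u' * f x) f"
      using UR by (auto intro!: gibbs_cong)
    ultimately show ?thesis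
      using gibbs_indicator_increment[of R B u' u T, OF _ u True] by (simp add: b_def f_def)
  qed
  finally show ?thesis
    using err by (simp add: \<epsilon>_def \<epsilon>'_def algebra_simps)
qed

end

section \<open>Tours and 2-opt moves\<close>

definition standard_tour :: "nat \<Rightarrow> nat set set" where
  "standard_tour n = (\<lambda>i. {i, Suc i mod n}) ` {..<n}"

text \<open>Applied to the standard tour, \<sigma> puts vertex \<sigma> i at position i. Composition
  from the left renames vertices, composition from the right rearranges positions.\<close>

abbreviation relabel :: "(nat \<Rightarrow> nat) \<Rightarrow> nat set set \<Rightarrow> nat set set" where
  "relabel \<sigma> x \<equiv> (`) \<sigma> ` x"

definition reversal :: "nat \<Rightarrow> nat \<Rightarrow> nat \<Rightarrow> nat" where
  "reversal i j k = (if i \<le> k \<and> k \<le> j then i + j - k else k)"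

lemma Suc_mod_eq: "i < n \<Longrightarrow> Suc i mod n = (if Suc i = n then 0 else Suc i)"
  by (simp add: mod_Suc)

lemma relabel_comp: "relabel \<sigma> (relabel \<tau> x) = relabel (\<sigma> \<circ> \<tau>) x"
  by (simp add: image_image image_comp)

lemma relabel_id [simp]: "relabel id x = x"
  by simp

lemma inj_image: "inj f \<Longrightarrow> inj ((`) f)"
  by (auto intro!: injI simp: inj_image_eq_iff)

lemma edgesI: "u < n \<Longrightarrow> v < n \<Longrightarrow> u \<noteq> v \<Longrightarrow> {u, v} \<in> edges n"
  unfolding edges_def by blast

lemma finite_edges: "finite (edges n)"
  by (rule finite_subset[of _ "Pow {..<n}"]) (auto simp: edges_def)

lemma cycle_edges_eq:
  "cycle_edges xs = (\<lambda>i. {xs ! i, xs ! (Suc i mod length xs)}) ` {..<length xs}"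
  by (auto simp: cycle_edges_def)

section \<open>Tours as relabellings of the standard tour\<close>

lemma tours_eq_relabel: "tours n = (\<lambda>\<sigma>. relabel \<sigma> (standard_tour n)) ` {\<sigma>. \<sigma> permutes {..<n}}"
proof (intro equalityI subsetI)
  fix x assume "x \<in> tours n"
  then obtain xs where xs: "set xs = {..<n}" "distinct xs" and x: "x = cycle_edges xs"
    by (auto simp: tours_def permutations_of_set_def)
  have len: "length xs = n"
    using xs distinct_card[of xs] by simp
  define \<sigma> where "\<sigma> i = (if i < n then xs ! i else i)" for i
  have "bij_betw ((!) xs) {..<n} {..<n}"
    using xs len by (intro bij_betw_nth) auto
  then have "bij_betw \<sigma> {..<n} {..<n}"
    by (subst bij_betw_cong[of _ _ "(!) xs"]) (auto simp: \<sigma>_def)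
  then have "\<sigma> permutes {..<n}"
    by (rule bij_imp_permutes) (auto simp: \<sigma>_def)
  moreover have "x = relabel \<sigma> (standard_tour n)"
    unfolding x cycle_edges_eq standard_tour_def image_image len
    by (intro image_cong refl) (auto simp: \<sigma>_def)
  ultimately show "x \<in> (\<lambda>\<sigma>. relabel \<sigma> (standard_tour n)) ` {\<sigma>. \<sigma> permutes {..<n}}"
    by auto
next
  fix x assume "x \<in> (\<lambda>\<sigma>. relabel \<sigma> (standard_tour n)) ` {\<sigma>. \<sigma> permutes {..<n}}"
  then obtain \<sigma> where \<sigma>: "\<sigma> permutes {..<n}" and x: "x = relabel \<sigma> (standard_tour n)"
    by auto
  define xs where "xs = map \<sigma> [0..<n]"
  have "xs \<in> permutations_of_set {..<n}"
    using permutes_image[OF \<sigma>] permutes_inj_on[OF \<sigma>]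
    by (auto simp: xs_def permutations_of_set_def distinct_map atLeast0LessThan)
  moreover have "x = cycle_edges xs"
    unfolding x cycle_edges_eq standard_tour_def image_image
    by (intro image_cong) (auto simp: xs_def)
  ultimately show "x \<in> tours n"
    by (auto simp: tours_def)
qed

lemma standard_tour_in_tours: "standard_tour n \<in> tours n"
  unfolding tours_eq_relabel by (rule image_eqI[of _ _ id]) (auto simp: permutes_id)

lemma relabel_tours:
  assumes "\<sigma> permutes {..<n}" "x \<in> tours n"
  shows "relabel \<sigma> x \<in> tours n"
proof -
  obtain \<tau> where \<tau>: "\<tau> permutes {..<n}" "x = relabel \<tau> (standard_tour n)"
    using assms(2) by (auto simp: tours_eq_relabel)
  show ?thesis
    unfolding tours_eq_relabel \<tau>(2) relabel_comp
    using permutes_compose[OF \<tau>(1) assms(1)] by blast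
qed

lemma finite_tours: "finite (tours n)" and card_tours_le: "card (tours n) \<le> n ^ n"
proof -
  show "finite (tours n)"
    by (simp add: tours_def)
  have "card (tours n) \<le> card (permutations_of_set {..<n})"
    unfolding tours_def by (rule card_image_le) simp
  also have "\<dots> \<le> n ^ n"
    by (simp add: fact_le_power[where 'a = nat, simplified])
  finally show "card (tours n) \<le> n ^ n" .
qed

lemma relabel_edges: "\<sigma> permutes {..<n} \<Longrightarrow> e \<in> edges n \<Longrightarrow> \<sigma> ` e \<in> edges n"
proof -
  assume \<sigma>: "\<sigma> permutes {..<n}" and "e \<in> edges n"
  then obtain u v where e: "e = {u, v}" "u < n" "v < n" "u \<noteq> v"
    by (auto simp: edges_def)
  then have "\<sigma> ` e = {\<sigma> u, \<sigma> v}" "\<sigma> u < n" "\<sigma> v < n" "\<sigma> u \<noteq> \<sigma> v"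
    using permutes_in_image[OF \<sigma>] permutes_inj[OF \<sigma>] by (auto simp: inj_eq)
  then show "\<sigma> ` e \<in> edges n"
    by (auto intro: edgesI)
qed

text \<open>Rotating the positions leaves the edge set unchanged, so vertex 0 can be brought to
  position 0. The segment reversals used later all avoid that position.\<close>

lemma tours_rooted:
  assumes "x \<in> tours n" "n > 0"
  obtains \<sigma> where "\<sigma> permutes {1..<n}" "x = relabel \<sigma> (standard_tour n)"
proof -
  obtain \<sigma> where \<sigma>: "\<sigma> permutes {..<n}" and x: "x = relabel \<sigma> (standard_tour n)"
    using assms by (auto simp: tours_eq_relabel)
  \<comment> \<open>The cyclic shift of the positions; its \<open>r\<close>-th power sends 0 to the
    position \<open>r\<close> of vertex 0.\<close>
  define \<rho> where "\<rho> i = (if i < n then Suc i mod n else i)" for i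
  have "inj_on \<rho> {..<n}"
    by (auto simp: \<rho>_def inj_on_def Suc_mod_eq split: if_splits)
  moreover have "\<rho> ` {..<n} \<subseteq> {..<n}"
    by (auto simp: \<rho>_def)
  ultimately have bij: "bij_betw \<rho> {..<n} {..<n}"
    by (simp add: bij_betw_def endo_inj_surj)
  then have \<rho>: "\<rho> permutes {..<n}"
    by (rule bij_imp_permutes) (auto simp: \<rho>_def)
  have "relabel \<rho> (standard_tour n) = (\<lambda>i. {i, Suc i mod n}) ` (\<rho> ` {..<n})"
    unfolding standard_tour_def image_image by (intro image_cong refl) (auto simp: \<rho>_def)
  also have "\<dots> = standard_tour n"
    using bij by (simp add: bij_betw_def standard_tour_def)
  finally have inv1: "relabel \<rho> (standard_tour n) = standard_tour n" .
  have inv: "relabel (\<rho> ^^ r) (standard_tour n) = standard_tour n" for r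
  proof (induction r)
    case (Suc r)
    then show ?case
      by (simp only: funpow.simps inv1 flip: relabel_comp)
  qed simp
  have pow: "(\<rho> ^^ r) permutes {..<n}" for r
  proof (induction r)
    case (Suc r)
    then show ?case
      unfolding funpow.simps by (rule permutes_compose) (rule \<rho>)
  qed (simp add: permutes_id[unfolded id_def])
  have pow0: "(\<rho> ^^ r) 0 = r" if "r < n" for r
    using that by (induction r) (auto simp: \<rho>_def)
  have "0 \<in> \<sigma> ` {..<n}"
    using permutes_image[OF \<sigma>] assms by simp
  then obtain r where r: "r < n" "\<sigma> r = 0" by auto
  define \<tau> where "\<tau> = \<sigma> \<circ> (\<rho> ^^ r)"
  have "\<tau> permutes {..<n}"
    unfolding \<tau>_def by (intro permutes_compose pow \<sigma>)
  then have "\<tau> permutes {1..<n}"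
    by (rule permutes_superset) (auto simp: \<tau>_def pow0 r Suc_le_eq)
  moreover have "x = relabel \<tau> (standard_tour n)"
    by (simp only: x \<tau>_def inv flip: relabel_comp)
  ultimately show ?thesis by (rule that)
qed

lemma permutes_rooted: "\<sigma> permutes {1..<n} \<Longrightarrow> \<sigma> permutes {..<n}"
  by (rule permutes_subset) auto

section \<open>Degrees and 2-opt neighbourhoods\<close>

context
  fixes n :: nat
  assumes n: "3 \<le> n"
begin

text \<open>For n = 2 this fails, as both arcs are {0, 1}.\<close>

lemma inj_on_arc: "inj_on (\<lambda>i. {i, Suc i mod n}) {..<n}"
  using n by (auto simp: inj_on_def doubleton_eq_iff Suc_mod_eq split: if_splits)

lemma standard_tour_degree:
  assumes "v < n"
  shows "card {e \<in> standard_tour n. v \<in> e} = 2"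
proof -
  define w where "w = (if v = 0 then n - 1 else v - 1)"
  have "{i \<in> {..<n}. v \<in> {i, Suc i mod n}} = {v, w}"
    using assms n by (auto simp: w_def Suc_mod_eq split: if_splits dest: dvd_imp_le)
  moreover have "{e \<in> standard_tour n. v \<in> e} = (\<lambda>i. {i, Suc i mod n}) ` {i \<in> {..<n}. v \<in> {i, Suc i mod n}}"
    by (auto simp: standard_tour_def)
  moreover have "v \<noteq> w" "w < n"
    using assms n by (auto simp: w_def)
  moreover have "{v, w} \<subseteq> {..<n}" using assms \<open>w < n\<close> by simp
  ultimately show ?thesis
    by (simp only: card_image[OF inj_on_subset[OF inj_on_arc]] card_2_iff) blast
qed

lemma tour_subset_edges: "x \<in> tours n \<Longrightarrow> x \<subseteq> edges n"
proof -
  have "standard_tour n \<subseteq> edges n"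
    using n by (auto simp: standard_tour_def Suc_mod_eq intro!: edgesI split: if_splits)
  moreover assume "x \<in> tours n"
  then obtain \<sigma> where "\<sigma> permutes {..<n}" "x = relabel \<sigma> (standard_tour n)"
    by (auto simp: tours_eq_relabel)
  ultimately show "x \<subseteq> edges n"
    by (auto intro: relabel_edges)
qed

lemma finite_tour: "x \<in> tours n \<Longrightarrow> finite x"
  using tour_subset_edges finite_edges finite_subset by blast

lemma card_tour: "x \<in> tours n \<Longrightarrow> card x = n"
proof -
  assume "x \<in> tours n"
  then obtain \<sigma> where \<sigma>: "\<sigma> permutes {..<n}" and x: "x = relabel \<sigma> (standard_tour n)"
    by (auto simp: tours_eq_relabel)
  have "card x = card (standard_tour n)"
    unfolding x by (intro card_image inj_on_image inj_on_subset[OF permutes_inj[OF \<sigma>]]) auto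
  also have "\<dots> = n"
    unfolding standard_tour_def by (simp add: card_image inj_on_arc)
  finally show "card x = n" .
qed

lemma tour_degree:
  assumes "x \<in> tours n"
  shows "card {e \<in> x. v \<in> e} = (if v < n then 2 else 0)"
proof (cases "v < n")
  case True
  obtain \<sigma> where \<sigma>: "\<sigma> permutes {..<n}" and x: "x = relabel \<sigma> (standard_tour n)"
    using assms by (auto simp: tours_eq_relabel)
  have "v \<in> \<sigma> ` {..<n}"
    using permutes_image[OF \<sigma>] True by simp
  then obtain w where w: "w < n" "\<sigma> w = v" by auto
  have "{e \<in> x. v \<in> e} = relabel \<sigma> {e \<in> standard_tour n. w \<in> e}"
    unfolding x w(2)[symmetric] by (auto simp: inj_image_mem_iff[OF permutes_inj[OF \<sigma>]] inj_eq[OF permutes_inj[OF \<sigma>]])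
  also have "card \<dots> = 2"
    unfolding standard_tour_degree[OF w(1), symmetric]
    by (intro card_image inj_on_image inj_on_subset[OF permutes_inj[OF \<sigma>]]) auto
  finally show ?thesis using True by simp
next
  case False
  have "{e \<in> x. v \<in> e} = {}"
    using False tour_subset_edges[OF assms] by (auto simp: edges_def)
  then show ?thesis
    using False by (simp only: card.empty if_False)
qed

text \<open>Since all degrees are 2 before and after the move, the inserted edges are disjoint and
  cover the same four vertices as the deleted ones.\<close>

lemma two_opt_exchange:
  assumes x: "x \<in> tours n" and y: "y \<in> two_opt n x"
  obtains e f e' f' where "e \<in> x" "f \<in> x" "e' \<in> edges n" "f' \<in> edges n"
    "e \<inter> f = {}" "e' \<inter> f' = {}" "e' \<union> f' = e \<union> f"
    "e' \<notin> x - {e, f}" "f' \<notin> x - {e, f}" "y = (x - {e, f}) \<union> {e', f'}"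
proof -
  obtain e f e' f' where ef: "e \<in> x" "f \<in> x" "e \<inter> f = {}" "e' \<in> edges n" "f' \<in> edges n"
    and y_eq: "y = (x - {e, f}) \<union> {e', f'}"
    using y by (auto simp: two_opt_def)
  have yt: "y \<in> tours n" using y by (auto simp: two_opt_def)
  note fin = finite_tour[OF x]
  have "e \<noteq> {}" using ef tour_subset_edges[OF x] by (auto simp: edges_def)
  then have "e \<noteq> f" using ef by auto
  then have c: "card (x - {e, f}) = n - 2"
    using ef fin card_tour[OF x] by (simp add: card_Diff_subset)
  have new: "e' \<noteq> f' \<and> e' \<notin> x - {e, f} \<and> f' \<notin> x - {e, f}"
  proof (rule ccontr)
    assume "\<not> ?thesis"
    then have "y = insert e' (x - {e, f}) \<or> y = insert f' (x - {e, f})"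
      using y_eq by auto
    moreover have "card (insert g (x - {e, f})) \<le> n - 1" for g
      using c n by (intro card_insert_le_m1) auto
    ultimately have "card y \<le> n - 1"
      by auto
    then show False using card_tour[OF yt] n by simp
  qed
  define r where "r v = card {g \<in> x - {e, f}. v \<in> g}" for v
  have split: "card {g \<in> z \<union> {a, b}. v \<in> g} = card {g \<in> z. v \<in> g} + (of_bool (v \<in> a) + of_bool (v \<in> b))"
    if "finite z" "a \<notin> z" "b \<notin> z" "a \<noteq> b" for z a b and v :: nat
  proof -
    have "{g \<in> z \<union> {a, b}. v \<in> g} = {g \<in> z. v \<in> g} \<union> ((if v \<in> a then {a} else {}) \<union> (if v \<in> b then {b} else {}))"
      by auto
    also have "card \<dots> = card {g \<in> z. v \<in> g} + card ((if v \<in> a then {a} else {}) \<union> (if v \<in> b then {b} else {}))"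
      using that by (intro card_Un_disjoint) auto
    finally show ?thesis using that by auto
  qed
  have x_eq: "x = (x - {e, f}) \<union> {e, f}" using ef by auto
  have deg: "of_bool (v \<in> e') + of_bool (v \<in> f') = (of_bool (v \<in> e) + of_bool (v \<in> f) :: nat)" for v
  proof -
    have "card {g \<in> y. v \<in> g} = r v + (of_bool (v \<in> e') + of_bool (v \<in> f'))"
      unfolding y_eq r_def using fin new by (intro split) auto
    moreover have "card {g \<in> x. v \<in> g} = r v + (of_bool (v \<in> e) + of_bool (v \<in> f))"
      unfolding r_def using fin \<open>e \<noteq> f\<close> by (subst x_eq, intro split) auto
    ultimately show ?thesis
      using tour_degree[OF x, of v] tour_degree[OF yt, of v] by simp
  qed
  have iff: "v \<in> e' \<union> f' \<longleftrightarrow> v \<in> e \<union> f" and disj: "\<not> (v \<in> e' \<and> v \<in> f')" for v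
    using deg[of v] ef(3) by (auto simp: of_bool_def split: if_splits)
  then have "e' \<inter> f' = {}" "e' \<union> f' = e \<union> f" by blast+
  then show thesis
    using that[of e f e' f'] ef new y_eq by auto
qed

lemma two_opt_subset: "two_opt n x \<subseteq> tours n"
  by (auto simp: two_opt_def)

text \<open>The definition speaks of disjointness for the deleted edges. The move back deletes the
  inserted ones, so their disjointness, from \<open>two_opt_exchange\<close>, is the point.\<close>

lemma two_opt_sym:
  assumes x: "x \<in> tours n" and y: "y \<in> two_opt n x"
  shows "x \<in> two_opt n y"
proof -
  obtain e f e' f' where ef: "e \<in> x" "f \<in> x" "e' \<in> edges n" "f' \<in> edges n"
    "e \<inter> f = {}" "e' \<inter> f' = {}" "e' \<union> f' = e \<union> f"
    "e' \<notin> x - {e, f}" "f' \<notin> x - {e, f}" and y_eq: "y = (x - {e, f}) \<union> {e', f'}"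
    using two_opt_exchange[OF x y] .
  have "x = (y - {e', f'}) \<union> {e, f}"
    using ef y_eq by blast
  moreover have "e \<in> edges n" "f \<in> edges n"
    using ef tour_subset_edges[OF x] by auto
  moreover have "e' \<in> y" "f' \<in> y" "x \<noteq> y"
    using y y_eq by (auto simp: two_opt_def)
  ultimately show ?thesis
    using x ef(6) unfolding two_opt_def mem_Collect_eq by (intro conjI bexI) assumption+
qed

lemma relabel_two_opt:
  assumes \<sigma>: "\<sigma> permutes {..<n}" and y: "y \<in> two_opt n x"
  shows "relabel \<sigma> y \<in> two_opt n (relabel \<sigma> x)"
proof -
  obtain e f e' f' where ef: "e \<in> x" "f \<in> x" "e \<inter> f = {}" "e' \<in> edges n" "f' \<in> edges n"
    and y_eq: "y = (x - {e, f}) \<union> {e', f'}"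
    using y by (auto simp: two_opt_def)
  note inj = permutes_inj[OF \<sigma>]
  have inj2: "inj ((`) \<sigma>)" using inj by (rule inj_image)
  have "relabel \<sigma> y = (relabel \<sigma> x - {\<sigma> ` e, \<sigma> ` f}) \<union> {\<sigma> ` e', \<sigma> ` f'}"
    unfolding y_eq image_Un image_set_diff[OF inj2] by simp
  moreover have "\<sigma> ` e \<inter> \<sigma> ` f = {}"
    using ef(3) by (simp flip: image_Int[OF inj])
  moreover have "relabel \<sigma> y \<noteq> relabel \<sigma> x"
    using y by (auto simp: two_opt_def inj_image_eq_iff[OF inj2])
  moreover have "relabel \<sigma> y \<in> tours n" "\<sigma> ` e' \<in> edges n" "\<sigma> ` f' \<in> edges n"
    using y ef by (auto simp: two_opt_def intro: relabel_tours[OF \<sigma>] relabel_edges[OF \<sigma>])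
  moreover have "\<sigma> ` e \<in> relabel \<sigma> x" "\<sigma> ` f \<in> relabel \<sigma> x"
    using ef by auto
  ultimately show ?thesis
    unfolding two_opt_def mem_Collect_eq by (intro conjI bexI) assumption+
qed

lemma finite_two_opt: "finite (two_opt n x)"
  using two_opt_subset finite_tours finite_subset by blast

text \<open>Relabelling acts transitively on tours and injectively on sets of tours, so every
  neighbourhood embeds into every other.\<close>

lemma card_two_opt_eq:
  assumes "x \<in> tours n" "y \<in> tours n"
  shows "card (two_opt n x) = card (two_opt n y)"
proof -
  have le: "card (two_opt n x) \<le> card (two_opt n y)" if xy: "x \<in> tours n" "y \<in> tours n" for x y
  proof -
    obtain \<sigma> \<tau> where \<sigma>: "\<sigma> permutes {..<n}" "x = relabel \<sigma> (standard_tour n)"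
      and \<tau>: "\<tau> permutes {..<n}" "y = relabel \<tau> (standard_tour n)"
      using xy by (auto simp: tours_eq_relabel)
    define \<rho> where "\<rho> = \<tau> \<circ> inv \<sigma>"
    have \<rho>: "\<rho> permutes {..<n}"
      unfolding \<rho>_def by (intro permutes_compose permutes_inv \<sigma> \<tau>)
    have "\<rho> \<circ> \<sigma> = \<tau>"
      unfolding \<rho>_def using permutes_inv_o(2)[OF \<sigma>(1)] by (simp add: comp_assoc)
    then have y: "relabel \<rho> x = y"
      by (simp only: \<sigma>(2) \<tau>(2) relabel_comp)
    show ?thesis
    proof (rule card_inj_on_le[OF _ _ finite_two_opt])
      show "inj_on (relabel \<rho>) (two_opt n x)"
        using inj_image[OF inj_image[OF permutes_inj[OF \<rho>]]] by (rule inj_on_subset) auto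
      show "relabel \<rho> ` two_opt n x \<subseteq> two_opt n y"
        using relabel_two_opt[OF \<rho>] y by auto
    qed
  qed
  show ?thesis
    using le assms by (intro antisym) auto
qed

text \<open>A move is determined by two edges of the tour and two subsets of their at most four
  endpoints, hence \<open>n\<^sup>2\<close> times 16 * 16.\<close>

lemma card_two_opt_le:
  assumes x: "x \<in> tours n"
  shows "card (two_opt n x) \<le> 256 * n\<^sup>2"
proof -
  define P where "P = (\<lambda>(e :: nat set, f). Pow (e \<union> f) \<times> Pow (e \<union> f))"
  have card2: "card e = 2" "finite e" if "e \<in> x" for e
    using that tour_subset_edges[OF x] by (auto simp: edges_def)
  have P: "finite (P p) \<and> card (P p) \<le> 256" if p: "p \<in> x \<times> x" for p
  proof -
    obtain e f where [simp]: "p = (e, f)" "e \<in> x" "f \<in> x" using p by auto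
    have "card (e \<union> f) \<le> 4"
      using card_Un_le[of e f] card2 by simp
    then have "(2 :: nat) ^ card (e \<union> f) * 2 ^ card (e \<union> f) \<le> 2 ^ 4 * 2 ^ 4"
      by (intro mult_mono power_increasing) auto
    then show ?thesis
      using card2 by (simp add: P_def card_cartesian_product card_Pow)
  qed
  have "two_opt n x \<subseteq> (\<lambda>((e, f), (e', f')). (x - {e, f}) \<union> {e', f'}) ` Sigma (x \<times> x) P"
  proof
    fix y assume "y \<in> two_opt n x"
    from two_opt_exchange[OF x this] obtain e f e' f' where "e \<in> x" "f \<in> x"
      "e' \<union> f' = e \<union> f" "y = (x - {e, f}) \<union> {e', f'}" by metis
    then show "y \<in> (\<lambda>((e, f), (e', f')). (x - {e, f}) \<union> {e', f'}) ` Sigma (x \<times> x) P"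
      by (intro image_eqI[of _ _ "((e, f), (e', f'))"]) (auto simp: P_def)
  qed
  then have "card (two_opt n x) \<le> card (Sigma (x \<times> x) P)"
    using P finite_tour[OF x] by (intro surj_card_le) auto
  also have "\<dots> = (\<Sum>p\<in>x \<times> x. card (P p))"
    using P finite_tour[OF x] by (intro card_SigmaI) auto
  also have "\<dots> \<le> (\<Sum>p\<in>x \<times> x. 256)"
    using P by (intro sum_mono) auto
  also have "\<dots> = 256 * n\<^sup>2"
    using card_tour[OF x] by (simp add: card_cartesian_product power2_eq_square)
  finally show ?thesis .
qed

section \<open>Segment reversals\<close>

lemma reversal_permutes: "1 \<le> i \<Longrightarrow> j < n \<Longrightarrow> reversal i j permutes {1..<n}"
proof (rule bij_imp_permutes)
  assume "1 \<le> i" "j < n"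
  then show "bij_betw (reversal i j) {1..<n} {1..<n}"
    by (intro bij_betw_byWitness[where f' = "reversal i j"]) (auto simp: reversal_def)
  show "reversal i j k = k" if "k \<notin> {1..<n}" for k
    using that \<open>1 \<le> i\<close> \<open>j < n\<close> by (auto simp: reversal_def)
qed

text \<open>Arcs inside the segment are permuted by \<open>\<tau>\<close> and arcs outside are
  fixed, so only the two boundary arcs change. For \<open>i = 1\<close> and \<open>j = n - 1\<close>
  these share vertex 0, and the reversal merely flips the orientation of the tour.\<close>

lemma reversal_two_opt:
  assumes ij: "1 \<le> i" "i < j" "j < n" and proper: "\<not> (i = 1 \<and> j = n - 1)"
  shows "relabel (reversal i j) (standard_tour n) \<in> two_opt n (standard_tour n)"
proof -
  define arc where "arc k = {k, Suc k mod n}" for k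
  define K where "K = {..<n} - {i - 1, j}"
  define \<tau> where "\<tau> k = (if i \<le> k \<and> k < j then i + j - 1 - k else k)" for k
  let ?r = "reversal i j"
  have x: "standard_tour n = arc ` {..<n}"
    unfolding standard_tour_def arc_def[abs_def] ..
  have \<tau>: "\<tau> ` K = K"
  proof -
    have "\<tau> k \<in> K" "\<tau> (\<tau> k) = k" if "k \<in> K" for k
      using that ij by (auto simp: \<tau>_def K_def)
    then show ?thesis by (metis (no_types, lifting) image_eqI image_subsetI subsetI subset_antisym)
  qed
  have "?r ` arc k = arc (\<tau> k)" if "k \<in> K" for k
  proof -
    consider "k < i - 1" | "i \<le> k" "k < j" | "j < k" "k < n"
      using \<open>k \<in> K\<close> unfolding K_def by fastforce
    then show ?thesis
    proof cases
      case 1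
      then show ?thesis using ij by (auto simp: arc_def \<tau>_def reversal_def Suc_mod_eq)
    next
      case 2
      then have "Suc k mod n = Suc k" "Suc (i + j - 1 - k) mod n = i + j - k"
        using ij by (auto simp: Suc_mod_eq)
      moreover have "?r k = i + j - k" "?r (Suc k) = i + j - 1 - k"
        using 2 by (auto simp: reversal_def)
      ultimately show ?thesis using 2 by (auto simp: arc_def \<tau>_def)
    next
      case 3
      then show ?thesis using ij by (auto simp: arc_def \<tau>_def reversal_def Suc_mod_eq)
    qed
  qed
  then have "relabel ?r (arc ` K) = arc ` \<tau> ` K"
    unfolding image_image by (intro image_cong refl) auto
  also have "\<dots> = arc ` K" by (simp add: \<tau>)
  also have "\<dots> = arc ` {..<n} - arc ` {i - 1, j}"
    unfolding K_def using inj_on_arc ij by (intro inj_on_image_set_diff[of _ "{..<n}"]) (auto simp: arc_def[abs_def])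
  finally have rest: "relabel ?r (arc ` K) = standard_tour n - {arc (i - 1), arc j}"
    by (simp add: x)
  have "{..<n} = K \<union> {i - 1, j}" using ij by (auto simp: K_def)
  then have "relabel ?r (standard_tour n) = relabel ?r (arc ` K) \<union> {?r ` arc (i - 1), ?r ` arc j}"
    unfolding x by auto
  also have "?r ` arc (i - 1) = {i - 1, j}"
    using ij by (auto simp: arc_def reversal_def)
  also have "?r ` arc j = {i, Suc j mod n}"
    using ij by (auto simp: arc_def reversal_def Suc_mod_eq)
  finally have y: "relabel ?r (standard_tour n)
      = (standard_tour n - {arc (i - 1), arc j}) \<union> {{i - 1, j}, {i, Suc j mod n}}"
    by (simp add: rest)
  have "{i - 1, j} \<notin> standard_tour n"
  proof
    assume "{i - 1, j} \<in> standard_tour n"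
    then obtain k where "k < n" "{i - 1, j} = {k, Suc k mod n}" by (auto simp: standard_tour_def)
    then show False using ij proper by (auto simp: doubleton_eq_iff Suc_mod_eq split: if_splits)
  qed
  moreover have "{i - 1, j} \<in> relabel ?r (standard_tour n)"
    unfolding y by simp
  ultimately have "relabel ?r (standard_tour n) \<noteq> standard_tour n" by metis
  moreover have "relabel ?r (standard_tour n) \<in> tours n"
    using ij by (intro relabel_tours permutes_rooted reversal_permutes standard_tour_in_tours) auto
  moreover have "arc (i - 1) \<in> standard_tour n" "arc j \<in> standard_tour n"
    using ij by (auto simp: x)
  moreover have "arc (i - 1) \<inter> arc j = {}"
    using ij proper by (auto simp: arc_def Suc_mod_eq split: if_splits)
  moreover have "{i - 1, j} \<in> edges n"
    using ij by (intro edgesI) auto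
  moreover have "{i, Suc j mod n} \<in> edges n"
    using ij by (intro edgesI) (auto simp: Suc_mod_eq)
  ultimately show ?thesis
    unfolding two_opt_def mem_Collect_eq using y by (intro conjI bexI) assumption+
qed

end

text \<open>The outer reversal undoes the inner one except at the two ends.\<close>

lemma transpose_eq_reversals:
  assumes "i < j"
  shows "Transposition.transpose i j = reversal i j \<circ> reversal (Suc i) (j - 1)"
  using assms by (auto simp: fun_eq_iff reversal_def Transposition.transpose_def)

section \<open>A Poincare inequality for the 2-opt graph\<close>

definition rooted :: "nat \<Rightarrow> (nat \<Rightarrow> nat) set" where
  "rooted n = {\<sigma>. \<sigma> permutes {1..<n}}"

definition rooted_tour :: "nat \<Rightarrow> (nat \<Rightarrow> nat) \<Rightarrow> nat set set" where
  "rooted_tour n \<sigma> = relabel \<sigma> (standard_tour n)"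

text \<open>Each tour is counted once per orientation. The number stays a symbol, since it cancels
  from the Poincare inequality.\<close>

definition rooted_multiplicity :: "nat \<Rightarrow> nat" where
  "rooted_multiplicity n = card {\<sigma> \<in> rooted n. rooted_tour n \<sigma> = standard_tour n}"

lemma finite_rooted: "finite (rooted n)"
  by (simp add: rooted_def finite_permutations)

lemma rooted_comp: "\<sigma> \<in> rooted n \<Longrightarrow> \<tau> \<in> rooted n \<Longrightarrow> \<sigma> \<circ> \<tau> \<in> rooted n"
  by (simp add: rooted_def permutes_compose)

lemma rooted_tour_comp: "rooted_tour n (\<sigma> \<circ> \<tau>) = relabel \<sigma> (rooted_tour n \<tau>)"
  by (simp add: rooted_tour_def relabel_comp)

lemma rooted_tour_in_tours: "\<sigma> \<in> rooted n \<Longrightarrow> rooted_tour n \<sigma> \<in> tours n"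
  unfolding rooted_tour_def rooted_def
  by (intro relabel_tours permutes_rooted standard_tour_in_tours) simp

lemma rooted_multiplicity_pos: "rooted_multiplicity n > 0"
proof -
  have "id \<in> {\<sigma> \<in> rooted n. rooted_tour n \<sigma> = standard_tour n}"
    by (simp add: rooted_def rooted_tour_def permutes_id)
  then show ?thesis
    unfolding rooted_multiplicity_def using finite_rooted by (subst card_gt_0_iff) auto
qed

lemma sum_rooted_right:
  assumes "\<pi> \<in> rooted n"
  shows "(\<Sum>\<sigma>\<in>rooted n. g (\<sigma> \<circ> \<pi>)) = (\<Sum>\<sigma>\<in>rooted n. g \<sigma>)"
  using sum_permutations_compose_right[of \<pi> "{1..<n}" g] assms by (simp add: rooted_def)

lemma sum_rooted_left:
  assumes "\<sigma> \<in> rooted n"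
  shows "(\<Sum>\<pi>\<in>rooted n. g (\<sigma> \<circ> \<pi>)) = (\<Sum>\<pi>\<in>rooted n. g \<pi>)"
proof -
  have \<sigma>: "\<sigma> permutes {1..<n}" using assms by (simp add: rooted_def)
  have inv: "\<sigma> \<circ> (inv \<sigma> \<circ> \<tau>) = \<tau>" "inv \<sigma> \<circ> (\<sigma> \<circ> \<tau>) = \<tau>" for \<tau>
    using permutes_inv_o[OF \<sigma>] by (simp_all flip: comp_assoc)
  have "inv \<sigma> \<in> rooted n"
    using permutes_inv[OF \<sigma>] by (simp add: rooted_def)
  then have "bij_betw ((\<circ>) \<sigma>) (rooted n) (rooted n)"
    using assms by (intro bij_betw_byWitness[where f' = "(\<circ>) (inv \<sigma>)"])
      (auto simp only: inv intro: rooted_comp)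
  then show ?thesis by (rule sum.reindex_bij_betw)
qed

lemma card_rooted_fiber:
  assumes "x \<in> tours n" "n > 0"
  shows "card {\<sigma> \<in> rooted n. rooted_tour n \<sigma> = x} = rooted_multiplicity n"
proof -
  obtain \<sigma> where \<sigma>: "\<sigma> permutes {1..<n}" and x: "x = relabel \<sigma> (standard_tour n)"
    using tours_rooted[OF assms] .
  have inv: "\<sigma> \<circ> (inv \<sigma> \<circ> \<tau>) = \<tau>" "inv \<sigma> \<circ> (\<sigma> \<circ> \<tau>) = \<tau>" for \<tau>
    using permutes_inv_o[OF \<sigma>] by (simp_all flip: comp_assoc)
  have \<sigma>': "\<sigma> \<in> rooted n" "inv \<sigma> \<in> rooted n"
    using \<sigma> permutes_inv by (auto simp: rooted_def)
  have rx: "relabel (inv \<sigma>) x = standard_tour n" "relabel \<sigma> (standard_tour n) = x"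
    using permutes_inv_o(2)[OF \<sigma>] by (simp_all only: x relabel_comp relabel_id)
  have "bij_betw (\<lambda>\<tau>. \<sigma> \<circ> \<tau>) {\<tau> \<in> rooted n. rooted_tour n \<tau> = standard_tour n} {\<tau> \<in> rooted n. rooted_tour n \<tau> = x}"
  proof (rule bij_betw_byWitness[where f' = "\<lambda>\<tau>. inv \<sigma> \<circ> \<tau>"])
    show "(\<lambda>\<tau>. \<sigma> \<circ> \<tau>) ` {\<tau> \<in> rooted n. rooted_tour n \<tau> = standard_tour n} \<subseteq> {\<tau> \<in> rooted n. rooted_tour n \<tau> = x}"
      by (rule image_subsetI) (simp add: rooted_tour_comp rooted_comp \<sigma>' rx)
    show "(\<lambda>\<tau>. inv \<sigma> \<circ> \<tau>) ` {\<tau> \<in> rooted n. rooted_tour n \<tau> = x} \<subseteq> {\<tau> \<in> rooted n. rooted_tour n \<tau> = standard_tour n}"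
      by (rule image_subsetI) (simp add: rooted_tour_comp rooted_comp \<sigma>' rx)
  qed (simp_all add: inv)
  from bij_betw_same_card[OF this] show ?thesis
    by (simp add: rooted_multiplicity_def)
qed

lemma sum_rooted_tour:
  fixes g :: "nat set set \<Rightarrow> real"
  assumes "n > 0"
  shows "(\<Sum>\<sigma>\<in>rooted n. g (rooted_tour n \<sigma>)) = rooted_multiplicity n * (\<Sum>x\<in>tours n. g x)"
proof -
  have "(\<Sum>\<sigma>\<in>rooted n. g (rooted_tour n \<sigma>))
      = (\<Sum>x\<in>tours n. \<Sum>\<sigma>\<in>{\<sigma> \<in> rooted n. rooted_tour n \<sigma> = x}. g (rooted_tour n \<sigma>))"
    using finite_rooted finite_tours rooted_tour_in_tours by (intro sum.group[symmetric]) auto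
  also have "\<dots> = (\<Sum>x\<in>tours n. rooted_multiplicity n * g x)"
    using card_rooted_fiber assms by (intro sum.cong refl) simp
  finally show ?thesis by (simp add: sum_distrib_left)
qed

section \<open>Displacement as a length function on permutations\<close>

definition displacement :: "nat \<Rightarrow> (nat set set \<Rightarrow> real) \<Rightarrow> (nat \<Rightarrow> nat) \<Rightarrow> real" where
  "displacement n f \<pi> = L2_set (\<lambda>\<sigma>. f (rooted_tour n \<sigma>) - f (rooted_tour n (\<sigma> \<circ> \<pi>))) (rooted n)"

lemma displacement_id: "displacement n f id = 0"
  by (simp add: displacement_def L2_set_def)

text \<open>The L2 triangle inequality; the second leg starts at
  \<open>\<sigma> \<circ> \<pi>\<close>, which again runs once through \<open>rooted n\<close>.
  Bounding displacements thus reduces to generators of the permutation group.\<close>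

lemma displacement_comp:
  assumes "\<pi> \<in> rooted n" "\<rho> \<in> rooted n"
  shows "displacement n f (\<pi> \<circ> \<rho>) \<le> displacement n f \<pi> + displacement n f \<rho>"
proof -
  let ?F = "\<lambda>\<sigma>. f (rooted_tour n \<sigma>)"
  have "displacement n f (\<pi> \<circ> \<rho>)
      = L2_set (\<lambda>\<sigma>. (?F \<sigma> - ?F (\<sigma> \<circ> \<pi>)) + (?F (\<sigma> \<circ> \<pi>) - ?F (\<sigma> \<circ> \<pi> \<circ> \<rho>))) (rooted n)"
    by (simp add: displacement_def comp_assoc)
  also have "\<dots> \<le> displacement n f \<pi> + L2_set (\<lambda>\<sigma>. ?F (\<sigma> \<circ> \<pi>) - ?F (\<sigma> \<circ> \<pi> \<circ> \<rho>)) (rooted n)"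
    unfolding displacement_def by (rule L2_set_triangle_ineq)
  also have "L2_set (\<lambda>\<sigma>. ?F (\<sigma> \<circ> \<pi>) - ?F (\<sigma> \<circ> \<pi> \<circ> \<rho>)) (rooted n) = displacement n f \<rho>"
    unfolding displacement_def L2_set_def
    using sum_rooted_right[OF assms(1), of "\<lambda>\<sigma>. (?F \<sigma> - ?F (\<sigma> \<circ> \<rho>))\<^sup>2"] by simp
  finally show ?thesis .
qed

definition local_energy :: "nat \<Rightarrow> (nat set set \<Rightarrow> real) \<Rightarrow> real" where
  "local_energy n f = (\<Sum>z\<in>tours n. \<Sum>x\<in>two_opt n z. \<Sum>y\<in>two_opt n z. (f x - f y)\<^sup>2)"

lemma local_energy_nonneg: "local_energy n f \<ge> 0"
  unfolding local_energy_def by (intro sum_nonneg) auto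

text \<open>A transposition of two positions at distance at least 3 is the product of two segment
  reversals, i.e. leads from one neighbour of a common tour to another one.\<close>

lemma displacement_far_transpose:
  assumes ij: "1 \<le> i" "i + 3 \<le> j" "j < n" "\<not> (i = 1 \<and> j = n - 1)"
  shows "displacement n f (Transposition.transpose i j) \<le> sqrt (rooted_multiplicity n * local_energy n f)"
proof -
  let ?F = "\<lambda>\<sigma>. f (rooted_tour n \<sigma>)"
  have n: "3 \<le> n" using ij by simp
  define \<rho> where "\<rho> = reversal i j"
  define \<rho>' where "\<rho>' = reversal (Suc i) (j - 1)"
  have \<rho>: "\<rho> \<in> rooted n" "\<rho>' \<in> rooted n"
    using ij n reversal_permutes[OF n] unfolding \<rho>_def \<rho>'_def rooted_def by simp_all
  \<comment> \<open>Distance 3 leaves at least two positions in the inner segment, and excluding the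
    pair 1, n - 1 keeps the outer reversal from fixing the tour.\<close>
  have nb: "rooted_tour n (\<sigma> \<circ> \<tau>) \<in> two_opt n (rooted_tour n \<sigma>)"
    if "\<sigma> \<in> rooted n" "\<tau> \<in> {\<rho>, \<rho>'}" for \<sigma> \<tau>
  proof -
    have "rooted_tour n \<tau> \<in> two_opt n (standard_tour n)"
      using that(2) ij n unfolding rooted_tour_def \<rho>_def \<rho>'_def
      by (auto intro!: reversal_two_opt)
    then show ?thesis
      using that(1) relabel_two_opt[OF n permutes_rooted] unfolding rooted_tour_comp rooted_def rooted_tour_def[of n \<sigma>] by auto
  qed
  have "\<rho> \<circ> \<rho> = id"
    by (auto simp: \<rho>_def reversal_def fun_eq_iff)
  then have \<rho>\<rho>: "\<sigma> \<circ> \<rho> \<circ> (\<rho> \<circ> \<rho>') = \<sigma> \<circ> \<rho>'" for \<sigma>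
    by (metis comp_assoc comp_id)
  have transpose: "Transposition.transpose i j = \<rho> \<circ> \<rho>'"
    unfolding \<rho>_def \<rho>'_def using ij by (intro transpose_eq_reversals) simp
  \<comment> \<open>Shifting the summation by the involution \<rho> makes the tour of \<sigma> the
    common neighbour.\<close>
  have "(\<Sum>\<sigma>\<in>rooted n. (?F \<sigma> - ?F (\<sigma> \<circ> Transposition.transpose i j))\<^sup>2)
      = (\<Sum>\<sigma>\<in>rooted n. (?F (\<sigma> \<circ> \<rho>) - ?F (\<sigma> \<circ> \<rho> \<circ> (\<rho> \<circ> \<rho>')))\<^sup>2)"
    unfolding transpose
    by (rule sum_rooted_right[OF \<rho>(1), where g = "\<lambda>\<sigma>. (?F \<sigma> - ?F (\<sigma> \<circ> (\<rho> \<circ> \<rho>')))\<^sup>2", symmetric])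
  also have "\<dots> = (\<Sum>\<sigma>\<in>rooted n. (?F (\<sigma> \<circ> \<rho>) - ?F (\<sigma> \<circ> \<rho>'))\<^sup>2)"
    unfolding \<rho>\<rho> ..
  also have "\<dots> \<le> (\<Sum>\<sigma>\<in>rooted n. \<Sum>x\<in>two_opt n (rooted_tour n \<sigma>). \<Sum>y\<in>two_opt n (rooted_tour n \<sigma>). (f x - f y)\<^sup>2)"
  proof (rule sum_mono)
    fix \<sigma> assume \<sigma>: "\<sigma> \<in> rooted n"
    let ?N = "two_opt n (rooted_tour n \<sigma>)"
    have "(?F (\<sigma> \<circ> \<rho>) - ?F (\<sigma> \<circ> \<rho>'))\<^sup>2 \<le> (\<Sum>y\<in>?N. (?F (\<sigma> \<circ> \<rho>) - f y)\<^sup>2)"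
      using nb[OF \<sigma>, of \<rho>'] finite_two_opt[OF n]
      by (intro member_le_sum[where f = "\<lambda>y. (?F (\<sigma> \<circ> \<rho>) - f y)\<^sup>2"]) auto
    also have "\<dots> \<le> (\<Sum>x\<in>?N. \<Sum>y\<in>?N. (f x - f y)\<^sup>2)"
      using nb[OF \<sigma>, of \<rho>] finite_two_opt[OF n]
      by (intro member_le_sum[where f = "\<lambda>x. \<Sum>y\<in>?N. (f x - f y)\<^sup>2"]) (auto intro: sum_nonneg)
    finally show "(?F (\<sigma> \<circ> \<rho>) - ?F (\<sigma> \<circ> \<rho>'))\<^sup>2 \<le> (\<Sum>x\<in>?N. \<Sum>y\<in>?N. (f x - f y)\<^sup>2)" .
  qed
  also have "\<dots> = rooted_multiplicity n * local_energy n f"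
    unfolding local_energy_def using n
    by (subst sum_rooted_tour[where g = "\<lambda>z. \<Sum>x\<in>two_opt n z. \<Sum>y\<in>two_opt n z. (f x - f y)\<^sup>2"]) auto
  finally show ?thesis
    unfolding displacement_def L2_set_def by (rule real_sqrt_le_mono)
qed

text \<open>A pair that is not \<open>far\<close> is joined through a third position k that is far
  from both, as (i j) = (i k)(k j)(i k); this is the factor 3. With \<open>9 \<le> n\<close> there
  is room for k in every case.\<close>

lemma displacement_transpose:
  assumes n: "9 \<le> n" and ij: "i \<in> {1..<n}" "j \<in> {1..<n}"
  shows "displacement n f (Transposition.transpose i j) \<le> 3 * sqrt (rooted_multiplicity n * local_energy n f)"
proof -
  define K where "K = sqrt (rooted_multiplicity n * local_energy n f)"
  define far where "far i j \<longleftrightarrow> (i + 3 \<le> j \<and> \<not> (i = 1 \<and> j = n - 1)) \<or> (j + 3 \<le> i \<and> \<not> (j = 1 \<and> i = n - 1))" for i j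
  have K: "K \<ge> 0" by (simp add: K_def local_energy_nonneg)
  have d: "displacement n f (Transposition.transpose i j) \<le> K"
    if "far i j" "i \<in> {1..<n}" "j \<in> {1..<n}" for i j
    using that displacement_far_transpose[of i j n f] displacement_far_transpose[of j i n f]
    by (auto simp: far_def K_def transpose_commute)
  have t: "Transposition.transpose i j \<in> rooted n" if "i \<in> {1..<n}" "j \<in> {1..<n}" for i j
    using that by (auto simp: rooted_def intro: permutes_swap_id)
  consider "i = j" | "far i j" | "i \<noteq> j" "\<not> far i j" by blast
  then show ?thesis
  proof cases
    case 1
    then show ?thesis using K displacement_id[of n f] by (simp add: K_def id_def)
  next
    case 2
    then show ?thesis using d[of i j] ij K unfolding K_def by linarith
  next
    case 3
    have "\<exists>k. k \<in> {1..<n} \<and> k \<noteq> i \<and> k \<noteq> j \<and> far i k \<and> far k j"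
    proof -
      have *: "\<exists>k. k \<in> {1..<n} \<and> k \<noteq> i \<and> k \<noteq> j \<and> far i k \<and> far k j"
        if "i < j" "i \<in> {1..<n}" "j \<in> {1..<n}" "\<not> far i j" for i j
      proof -
        have "(i = 1 \<and> j = n - 1) \<or> j < i + 3"
          using that by (auto simp: far_def not_le)
        then consider "i = 1" "j = n - 1" | "j < i + 3" "i \<ge> 5"
          | "j < i + 3" "\<not> i \<ge> 5" "j + 3 < n" | "j < i + 3" "\<not> i \<ge> 5" "\<not> j + 3 < n"
          by blast
        then show ?thesis
        proof cases
          case 1
          then show ?thesis using n by (intro exI[of _ 5]) (auto simp: far_def)
        next
          case 2
          then show ?thesis using that n by (intro exI[of _ "i - 3"]) (auto simp: far_def)
        next
          case 3
          then show ?thesis using that n by (intro exI[of _ "j + 3"]) (auto simp: far_def)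
        next
          \<comment> \<open>Only n = 9, i = 4, j = 6 is left here.\<close>
          case 4
          then show ?thesis using that n by (intro exI[of _ "i - 3"]) (auto simp: far_def)
        qed
      qed
      have sym: "far i j = far j i" for i j by (auto simp: far_def)
      show ?thesis
        using *[of i j] *[of j i] 3 ij sym by (metis linorder_neqE_nat)
    qed
    then obtain k where k: "k \<in> {1..<n}" "k \<noteq> i" "k \<noteq> j" "far i k" "far k j" by blast
    have "Transposition.transpose i j = Transposition.transpose i k \<circ> (Transposition.transpose k j \<circ> Transposition.transpose i k)"
      using k 3 by (auto simp: fun_eq_iff Transposition.transpose_def)
    then have "displacement n f (Transposition.transpose i j) \<le> K + (K + K)"
      using d[OF k(4) ij(1) k(1)] d[OF k(5) k(1) ij(2)] t ij k
        displacement_comp[of "Transposition.transpose i k" n "Transposition.transpose k j \<circ> Transposition.transpose i k" f]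
        displacement_comp[of "Transposition.transpose k j" n "Transposition.transpose i k" f]
      by (fastforce intro: rooted_comp)
    then show ?thesis by (simp add: K_def)
  qed
qed

text \<open>A permutation of a finite set is a product of at most as many transpositions as the set
  has elements.\<close>

lemma displacement_le:
  assumes n: "9 \<le> n" and \<pi>: "\<pi> \<in> rooted n"
  shows "displacement n f \<pi> \<le> n * (3 * sqrt (rooted_multiplicity n * local_energy n f))"
proof -
  define K where "K = 3 * sqrt (rooted_multiplicity n * local_energy n f)"
  have "displacement n f \<pi> \<le> card I * K" if "finite I" "I \<subseteq> {1..<n}" "\<pi> permutes I" for I \<pi>
    using that
  proof (induction I arbitrary: \<pi> rule: finite_induct)
    case empty
    then show ?case using displacement_id[of n f] by (simp add: id_def)
  next
    case (insert a I)
    have "\<pi> \<in> {p. p permutes insert a I}" using insert.prems by simp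
    then obtain b \<rho> where b: "b \<in> insert a I" and \<rho>: "\<rho> permutes I" and \<pi>: "\<pi> = Transposition.transpose a b \<circ> \<rho>"
      unfolding permutes_insert by (elim imageE) (auto simp only: case_prod_beta mem_Collect_eq split_beta)
    have ab: "a \<in> {1..<n}" "b \<in> {1..<n}" using insert.prems(1) b by blast+
    have "\<rho> \<in> rooted n" "Transposition.transpose a b \<in> rooted n"
      using permutes_subset[OF \<rho>, of "{1..<n}"] permutes_swap_id[OF ab] insert.prems(1)
      by (simp_all add: rooted_def)
    then have "displacement n f \<pi> \<le> displacement n f (Transposition.transpose a b) + displacement n f \<rho>"
      unfolding \<pi> by (intro displacement_comp)
    also have "\<dots> \<le> K + card I * K"
      using displacement_transpose[OF n ab] insert.IH[OF _ \<rho>] insert.prems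
      by (intro add_mono) (auto simp: K_def)
    finally show ?case
      using insert.hyps by (simp add: algebra_simps)
  qed
  from this[of "{1..<n}" \<pi>] have "displacement n f \<pi> \<le> (n - 1) * K"
    using \<pi> by (simp add: rooted_def)
  also have "\<dots> \<le> n * K"
    by (intro mult_right_mono) (auto simp: K_def local_energy_nonneg)
  finally show ?thesis by (simp add: K_def)
qed

text \<open>Writing a pair of rooted permutations as \<open>\<sigma>\<close> and
  \<open>\<sigma> \<circ> \<pi>\<close> turns the sum over all pairs of tours into a sum of squared
  displacements. The constant is (3 n)^2 from \<open>displacement_le\<close>, halved because the sum
  over pairs is 2 * s * V.\<close>

lemma two_opt_poincare:
  fixes f :: "nat set set \<Rightarrow> real"
  assumes n: "9 \<le> n"
  shows "(\<Sum>x\<in>tours n. (f x - (\<Sum>z\<in>tours n. f z) / card (tours n))\<^sup>2) \<le> 9 * n\<^sup>2 / 2 * local_energy n f"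
proof -
  let ?F = "\<lambda>\<sigma>. f (rooted_tour n \<sigma>)"
  define c where "c = real (rooted_multiplicity n)"
  define s where "s = real (card (tours n))"
  define E where "E = local_energy n f"
  define \<mu> where "\<mu> = (\<Sum>z\<in>tours n. f z) / s"
  define V where "V = (\<Sum>x\<in>tours n. (f x - \<mu>)\<^sup>2)"
  have c: "c > 0" using rooted_multiplicity_pos by (simp add: c_def)
  have s: "s > 0"
    using finite_tours standard_tour_in_tours by (auto simp: s_def card_gt_0_iff)
  have card: "real (card (rooted n)) = c * s"
    using sum_rooted_tour[of n "\<lambda>_. 1"] n by (simp add: c_def s_def)
  have "(\<Sum>x\<in>tours n. \<Sum>y\<in>tours n. (f x - f y)\<^sup>2)
      = (\<Sum>x\<in>tours n. \<Sum>y\<in>tours n. (f x - \<mu>)\<^sup>2 - 2 * (f x - \<mu>) * (f y - \<mu>) + (f y - \<mu>)\<^sup>2)"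
    by (intro sum.cong refl) (simp add: power2_eq_square algebra_simps)
  also have "\<dots> = (\<Sum>x\<in>tours n. s * (f x - \<mu>)\<^sup>2 - 2 * (f x - \<mu>) * (\<Sum>y\<in>tours n. f y - \<mu>) + V)"
    by (simp add: sum.distrib sum_subtractf s_def V_def flip: sum_distrib_left)
  also have "(\<Sum>y\<in>tours n. f y - \<mu>) = 0"
    using s by (simp add: sum_subtractf \<mu>_def s_def)
  finally have pairs: "(\<Sum>x\<in>tours n. \<Sum>y\<in>tours n. (f x - f y)\<^sup>2) = 2 * s * V"
    by (simp add: sum.distrib V_def s_def flip: sum_distrib_left)
  have "(\<Sum>\<pi>\<in>rooted n. (displacement n f \<pi>)\<^sup>2) = (\<Sum>\<pi>\<in>rooted n. \<Sum>\<sigma>\<in>rooted n. (?F \<sigma> - ?F (\<sigma> \<circ> \<pi>))\<^sup>2)"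
    by (simp add: displacement_def L2_set_def sum_nonneg)
  also have "\<dots> = (\<Sum>\<sigma>\<in>rooted n. \<Sum>\<pi>\<in>rooted n. (?F \<sigma> - ?F (\<sigma> \<circ> \<pi>))\<^sup>2)"
    by (rule sum.swap)
  also have "\<dots> = (\<Sum>\<sigma>\<in>rooted n. \<Sum>\<tau>\<in>rooted n. (?F \<sigma> - ?F \<tau>)\<^sup>2)"
    by (intro sum.cong refl sum_rooted_left[where g = "\<lambda>\<tau>. (?F \<sigma> - ?F \<tau>)\<^sup>2" for \<sigma>])
  also have "\<dots> = (\<Sum>\<sigma>\<in>rooted n. c * (\<Sum>y\<in>tours n. (?F \<sigma> - f y)\<^sup>2))"
    using n sum_rooted_tour[of n "\<lambda>y. (?F _ - f y)\<^sup>2"] by (simp add: c_def)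
  also have "\<dots> = c * (c * (\<Sum>x\<in>tours n. \<Sum>y\<in>tours n. (f x - f y)\<^sup>2))"
    using n sum_rooted_tour[of n "\<lambda>x. \<Sum>y\<in>tours n. (f x - f y)\<^sup>2"] by (simp add: c_def flip: sum_distrib_left)
  finally have "c * (c * (2 * s * V)) = (\<Sum>\<pi>\<in>rooted n. (displacement n f \<pi>)\<^sup>2)"
    unfolding pairs by simp
  also have "\<dots> \<le> (\<Sum>\<pi>\<in>rooted n. (n * (3 * sqrt (c * E)))\<^sup>2)"
    using displacement_le[OF n, of _ f]
    by (intro sum_mono power_mono) (auto simp: displacement_def c_def E_def)
  also have "\<dots> = c * s * (9 * n\<^sup>2 * (c * E))"
    using c local_energy_nonneg by (simp add: card power_mult_distrib E_def)
  finally have "(2 * c\<^sup>2 * s) * V \<le> (2 * c\<^sup>2 * s) * (9 * n\<^sup>2 / 2 * E)"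
    by (simp add: power2_eq_square algebra_simps)
  moreover have "2 * c\<^sup>2 * s > 0" using c s by simp
  ultimately have "V \<le> 9 * n\<^sup>2 / 2 * E"
    by (subst (asm) mult_le_cancel_left_pos)
  then show ?thesis
    by (simp add: V_def \<mu>_def s_def E_def)
qed

section \<open>Simulated annealing as a Metropolis chain\<close>

lemma two_opt_nonempty: "9 \<le> n \<Longrightarrow> two_opt n (standard_tour n) \<noteq> {}"
proof -
  assume "9 \<le> n"
  then have "relabel (reversal 1 2) (standard_tour n) \<in> two_opt n (standard_tour n)"
    by (intro reversal_two_opt) auto
  then show ?thesis by blast
qed

lemma tours_metropolis_graph:
  assumes n: "9 \<le> n"
  shows "metropolis_graph (tours n) (two_opt n) (card (two_opt n (standard_tour n))) (9 * real n ^ 2 / 2)"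
proof
  have n3: "3 \<le> n" using n by simp
  show "tours n \<noteq> {}" using standard_tour_in_tours by auto
  show "x \<in> two_opt n y" if "x \<in> tours n" "y \<in> two_opt n x" for x y
    using two_opt_sym[OF n3 that] .
  show "card (two_opt n x) = card (two_opt n (standard_tour n))" if "x \<in> tours n" for x
    using card_two_opt_eq[OF n3 that standard_tour_in_tours] .
  show "card (two_opt n (standard_tour n)) > 0"
    using two_opt_nonempty[OF n] finite_two_opt[OF n3] by (simp add: card_gt_0_iff)
  show "(\<Sum>x\<in>tours n. (f x - (\<Sum>z\<in>tours n. f z) / card (tours n))\<^sup>2)
      \<le> 9 * real n ^ 2 / 2 * (\<Sum>z\<in>tours n. \<Sum>x\<in>two_opt n z. \<Sum>y\<in>two_opt n z. (f x - f y)\<^sup>2)" for f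
    using two_opt_poincare[OF n, of f] by (simp add: local_energy_def)
  show "two_opt n x \<subseteq> tours n" for x
    by (rule two_opt_subset[OF n3])
qed (use n finite_tours in auto)

text \<open>Length divided by temperature. At \<open>k = 1\<close> it is 0, so every proposal is
  accepted, in accordance with an infinite temperature.\<close>

definition energy :: "real \<Rightarrow> (nat set \<Rightarrow> real) \<Rightarrow> nat \<Rightarrow> nat set set \<Rightarrow> real" where
  "energy a W k x = ln (real k) / a * tour_length W x"

lemma expectation_finite:
  assumes "set_pmf q \<subseteq> A" "finite A"
  shows "measure_pmf.expectation q (f :: _ \<Rightarrow> real) = (\<Sum>x\<in>A. pmf q x * f x)"
  using integral_measure_pmf_real[of A q f] assms by (auto simp: mult.commute)

locale large_tours =
  fixes n :: nat
  assumes n9: "9 \<le> n"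
begin

lemma n3: "3 \<le> n" using n9 by simp

sublocale metropolis_graph "tours n" "two_opt n" "card (two_opt n (standard_tour n))" "9 * real n ^ 2 / 2"
  by (rule tours_metropolis_graph[OF n9])

lemma accept_prob_eq: "accept_prob W (temperature a k) x y = acc (energy a W k) x y"
proof -
  have "min 1 (exp (- u)) = exp (- max 0 u)" for u :: real
    by (auto simp: min_def max_def)
  moreover have "- (tour_length W y - tour_length W x) / temperature a k = - (energy a W k y - energy a W k x)"
    by (simp add: temperature_def energy_def algebra_simps diff_divide_distrib)
  ultimately show ?thesis
    unfolding accept_prob_def acc_def by metis
qed

lemma expectation_sa_step:
  assumes x: "x \<in> tours n"
  shows "measure_pmf.expectation (sa_step n W (temperature a k) x) f = step (energy a W k) f x"
proof -
  let ?N = "two_opt n x" and ?p = "acc (energy a W k) x"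
  have ne: "?N \<noteq> {}" using card_N[OF x] d_pos by auto
  have inner: "measure_pmf.expectation (bernoulli_pmf (?p y) \<bind> (\<lambda>b. return_pmf (if b then y else x))) f
      = f x + ?p y * (f y - f x)" for y
  proof -
    have "bernoulli_pmf (?p y) \<bind> (\<lambda>b. return_pmf (if b then y else x)) = map_pmf (\<lambda>b. if b then y else x) (bernoulli_pmf (?p y))"
      by (simp add: map_pmf_def)
    then show ?thesis
      using acc_bounds[of "energy a W k" x y] by (simp add: integral_map_pmf algebra_simps)
  qed
  have "measure_pmf.expectation (sa_step n W (temperature a k) x) f
      = (\<Sum>y\<in>?N. (f x + ?p y * (f y - f x)) /\<^sub>R real (card ?N))"
    unfolding sa_step_def using ne accept_prob_eq
    by (simp add: pmf_expectation_bind_pmf_of_set finite_two_opt[OF n3] inner)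
  also have "\<dots> = step (energy a W k) f x"
    using d_pos card_N[OF x] by (simp add: step_def sum.distrib distrib_left divide_inverse mult.commute[of _ "inverse _"] flip: sum_distrib_left)
  finally show ?thesis .
qed

lemma set_sa_step: "x \<in> tours n \<Longrightarrow> set_pmf (sa_step n W T x) \<subseteq> tours n"
  using two_opt_subset[OF n3, of x] finite_two_opt[OF n3, of x] by (auto simp: sa_step_def split: if_splits)

text \<open>Moving steps from the law to the observable reverses their order, which is harmless
  within an epoch because all its steps are equal.\<close>

lemma funpow_sa_step:
  fixes W :: "nat set \<Rightarrow> real" and a :: real and k :: nat
  assumes q: "set_pmf q \<subseteq> tours n"
  defines "F \<equiv> (\<lambda>q. bind_pmf q (sa_step n W (temperature a k)))"
  shows "set_pmf ((F ^^ s) q) \<subseteq> tours n"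
    and "measure_pmf.expectation ((F ^^ s) q) f = measure_pmf.expectation q ((step (energy a W k) ^^ s) f)"
proof -
  show set: "set_pmf ((F ^^ s) q) \<subseteq> tours n" for s
  proof (induction s)
    case (Suc s)
    then show ?case using set_sa_step by (fastforce simp: F_def)
  qed (use q in simp)
  show "measure_pmf.expectation ((F ^^ s) q) f = measure_pmf.expectation q ((step (energy a W k) ^^ s) f)"
  proof (induction s arbitrary: f)
    case (Suc s)
    let ?q = "(F ^^ s) q"
    have "measure_pmf.expectation ((F ^^ Suc s) q) f
        = (\<Sum>x\<in>tours n. pmf ?q x * measure_pmf.expectation (sa_step n W (temperature a k) x) f)"
      using set[of s] finite_tours set_sa_step
      by (simp add: F_def pmf_expectation_bind[of "tours n"] finite_subset[OF set_sa_step finite_tours])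
    also have "\<dots> = measure_pmf.expectation ?q (step (energy a W k) f)"
      using set[of s] finite_tours by (simp add: expectation_finite expectation_sa_step)
    finally show ?case
      by (simp add: Suc.IH funpow_swap1)
  qed simp
qed

lemma sa_law_run:
  assumes p: "set_pmf p \<subseteq> tours n"
  shows "set_pmf (sa_law n W a m p k) \<subseteq> tours n"
    and "measure_pmf.expectation (sa_law n W a m p k) f = measure_pmf.expectation p (run (energy a W) m k f)"
proof -
  show set: "set_pmf (sa_law n W a m p k) \<subseteq> tours n" for k
    by (induction k) (simp_all add: p funpow_sa_step)
  show "measure_pmf.expectation (sa_law n W a m p k) f = measure_pmf.expectation p (run (energy a W) m k f)"
    by (induction k arbitrary: f) (simp_all add: set funpow_sa_step)
qed

section \<open>Edge probabilities and their monotonicity\<close>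

definition edge_prob :: "real \<Rightarrow> (nat \<Rightarrow> nat) \<Rightarrow> nat set set pmf \<Rightarrow> nat \<Rightarrow> (nat set \<Rightarrow> real) \<Rightarrow> nat set \<Rightarrow> real" where
  "edge_prob a m p t W e = measure_pmf.expectation (sa_law n W a m p t) (\<lambda>x. of_bool (e \<in> x))"

lemma tour_length_bounds:
  assumes W: "\<And>e. e \<in> edges n \<Longrightarrow> 0 \<le> W e \<and> W e \<le> 1" and x: "x \<in> tours n"
  shows "0 \<le> tour_length W x" "tour_length W x \<le> n"
    and "y \<in> two_opt n x \<Longrightarrow> tour_length W y \<le> tour_length W x + 2"
proof -
  note sub = tour_subset_edges[OF n3 x] and fin = finite_tour[OF n3 x]
  show "0 \<le> tour_length W x"
    unfolding tour_length_def using W sub by (intro sum_nonneg) auto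
  have "tour_length W x \<le> (\<Sum>e\<in>x. 1)"
    unfolding tour_length_def using W sub by (intro sum_mono) auto
  then show "tour_length W x \<le> n"
    using card_tour[OF n3 x] by simp
  show "tour_length W y \<le> tour_length W x + 2" if "y \<in> two_opt n x"
  proof -
    obtain e f e' f' where ef: "e' \<in> edges n" "f' \<in> edges n" and y: "y = (x - {e, f}) \<union> {e', f'}"
      using \<open>y \<in> two_opt n x\<close> by (auto simp: two_opt_def)
    have "tour_length W y \<le> (\<Sum>g\<in>x - {e, f}. W g) + (\<Sum>g\<in>{e', f'}. W g)"
      unfolding tour_length_def y using fin W ef sub
      by (subst sum_Un) (auto intro!: sum_nonneg)
    also have "(\<Sum>g\<in>x - {e, f}. W g) \<le> (\<Sum>g\<in>x. W g)"
      using fin W sub by (intro sum_mono2) auto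
    also have "(\<Sum>g\<in>{e', f'}. W g) \<le> 2"
      using W[OF ef(1)] W[OF ef(2)] by (cases "e' = f'") auto
    finally show ?thesis by (simp add: tour_length_def)
  qed
qed

lemma tour_length_update:
  assumes "x \<in> tours n"
  shows "tour_length (W(e := w)) x = tour_length (W(e := 0)) x + w * of_bool (e \<in> x)"
proof -
  note fin = finite_tour[OF n3 assms]
  have "tour_length (W(e := w)) x = (\<Sum>g\<in>x. (W(e := 0)) g + (if g = e then w else 0))"
    unfolding tour_length_def by (intro sum.cong) auto
  also have "\<dots> = tour_length (W(e := 0)) x + w * of_bool (e \<in> x)"
    using fin by (simp add: sum.distrib tour_length_def)
  finally show ?thesis .
qed

text \<open>Tours have length at most n \<le> a, so the exponential of the energy is at most k \<le>
  t; this is the value of \<open>B\<close> from here on. The factor ln k / a is at most 1 by the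
  bound on ln t, and a 2-opt move inserts two edges of weight at most 1, hence the 2 in
  \<open>admissible\<close>.\<close>

lemma energy_admissible:
  fixes a :: real
  assumes W: "\<And>e. e \<in> edges n \<Longrightarrow> 0 \<le> W e \<and> W e \<le> 1"
    and a: "a \<ge> n" and k: "1 \<le> k" "k \<le> t" and t: "ln (real t) \<le> a"
  shows "admissible t (energy a W k)"
proof -
  have b: "0 \<le> ln (real k)" "ln (real k) \<le> ln (real t)" using k by auto
  have a0: "a > 0" using a n9 by linarith
  have "0 \<le> energy a W k x \<and> exp (energy a W k x) \<le> t \<and> (\<forall>y\<in>two_opt n x. energy a W k y \<le> energy a W k x + 2)"
    if x: "x \<in> tours n" for x
  proof (intro conjI ballI)
    note J = tour_length_bounds[where W = W, OF W x]
    have Ja: "tour_length W x \<le> a" using J(2) a by linarith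
    show "0 \<le> energy a W k x"
      using b a0 J by (simp add: energy_def)
    have "energy a W k x = ln (real k) * (tour_length W x / a)"
      by (simp add: energy_def)
    also have "\<dots> \<le> ln (real t) * 1"
      using b J(1) Ja a0 by (intro mult_mono) auto
    finally have "exp (energy a W k x) \<le> exp (ln (real t))" by simp
    then show "exp (energy a W k x) \<le> t" using k by simp
    fix y assume "y \<in> two_opt n x"
    then have "energy a W k y - energy a W k x \<le> ln (real k) / a * 2"
      unfolding energy_def right_diff_distrib[symmetric] using J(3)[of y] b a0
      by (intro mult_left_mono) auto
    also have "\<dots> \<le> 1 * 2"
      using b t a0 by (intro mult_right_mono) auto
    finally show "energy a W k y \<le> energy a W k x + 2" by simp
  qed
  then show ?thesis by (auto simp: admissible_def)
qed

text \<open>In epoch j the weight of \<open>e\<close> enters the energy of the tours through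
  \<open>e\<close> with coefficient ln j / a \<le> \<beta>, so raising it by w - w' is a
  perturbation of size at most \<beta> * (w - w') in all epochs. The initial law does not depend on
  the weights, so the inequality for each starting tour can be averaged.\<close>

lemma exp_edge_prob_mono:
  fixes W :: "nat set \<Rightarrow> real" and a \<gamma> w w' :: real and t :: nat
  assumes W: "\<And>g. g \<in> edges n \<Longrightarrow> 0 \<le> W g \<and> W g \<le> 1"
    and a: "a \<ge> n" and t: "1 \<le> t" "ln (real t) \<le> a"
    and p: "set_pmf p \<subseteq> tours n"
    and \<gamma>: "\<gamma> > 0" "2 * exp 4 * (256 * real n ^ 2)\<^sup>2 * (9 * real n ^ 2 / 2) * t * \<gamma> \<le> 1"
    and small: "2 * exp 2 * (t * real n ^ n) ^ 3 * exp (- (\<gamma> / 2 * m t))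
        * (2 * real (m t) * exp (\<gamma> / 2) + 2 * real t * (1 + 2 / \<gamma>)) \<le> 1"
    and w: "0 \<le> w'" "w' \<le> w" "w \<le> 1"
  defines "\<beta> \<equiv> ln (real t) / a"
  shows "exp (\<beta> * w') * edge_prob a m p t (W(e := w')) e \<le> exp (\<beta> * w) * edge_prob a m p t (W(e := w)) e"
proof -
  obtain k where k: "t = Suc k" using t by (cases t) auto
  let ?U = "energy a (W(e := w))" and ?U' = "energy a (W(e := w'))"
  let ?f = "\<lambda>x. of_bool (e \<in> x) :: real"
  have a0: "a > 0" using a n9 by linarith
  have \<beta>: "0 \<le> \<beta>" "\<beta> \<le> 1" using a0 t by (auto simp: \<beta>_def)
  have bw: "0 \<le> \<beta> * w'" "\<beta> * w' \<le> \<beta> * w" "\<beta> * w \<le> 1"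
    using \<beta> w by (auto intro: mult_left_mono mult_le_one)
  define D where "D = card (two_opt n (standard_tour n))"
  have D: "real D \<le> 256 * real n ^ 2"
    using card_two_opt_le[OF n3 standard_tour_in_tours] unfolding D_def
    by (metis of_nat_le_iff of_nat_mult of_nat_numeral of_nat_power)
  have "2 * exp 4 * (real D)\<^sup>2 * (9 * real n ^ 2 / 2) * t * \<gamma> \<le> 2 * exp 4 * (256 * real n ^ 2)\<^sup>2 * (9 * real n ^ 2 / 2) * t * \<gamma>"
    using \<gamma>(1) D by (intro mult_right_mono mult_left_mono power_mono) auto
  from order_trans[OF this \<gamma>(2)]
  have g: "2 * exp 4 * real (D\<^sup>2) * (9 * real n ^ 2 / 2) * t * \<gamma> \<le> 1"
    unfolding of_nat_power .
  have card: "real (card (tours n)) \<le> real n ^ n"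
    using card_tours_le[of n] by (metis of_nat_le_iff of_nat_power)
  have tc: "real t * card (tours n) \<le> real t * real n ^ n"
    by (rule mult_left_mono[OF card]) simp
  have "2 * exp 2 * (real t * card (tours n)) ^ 3 * exp (- (\<gamma> / 2 * m t))
        * (2 * real (m t) * exp (\<gamma> / 2) + 2 * real t * (1 + 2 / \<gamma>))
      \<le> 2 * exp 2 * (t * real n ^ n) ^ 3 * exp (- (\<gamma> / 2 * m t))
        * (2 * real (m t) * exp (\<gamma> / 2) + 2 * real t * (1 + 2 / \<gamma>))"
    using \<gamma>(1) by (intro mult_right_mono mult_left_mono power_mono tc) auto
  with small have sm: "2 * exp 2 * (real t * card (tours n)) ^ 3 * exp (- (\<gamma> / 2 * m t))
        * (2 * real (m t) * exp (\<gamma> / 2) + 2 * real t * (1 + 2 / \<gamma>)) \<le> 1" by linarith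
  have upd: "0 \<le> (W(e := v)) g \<and> (W(e := v)) g \<le> 1" if "g \<in> edges n" "0 \<le> v" "v \<le> 1" for g v
    using W that by simp
  have adm: "admissible t (energy a (W(e := v)) j)" if "1 \<le> j" "j \<le> t" "0 \<le> v" "v \<le> 1" for j v
  proof (rule energy_admissible[where W = "W(e := v)", OF _ a that(1,2) t(2)])
    show "0 \<le> (W(e := v)) g \<and> (W(e := v)) g \<le> 1" if "g \<in> edges n" for g
      by (rule upd[OF that \<open>0 \<le> v\<close> \<open>v \<le> 1\<close>])
  qed
  have bilinear: "l * (A + w * P) - l * (B + w * Q) - (l * (A + w' * P) - l * (B + w' * Q)) = l * (w - w') * (P - Q)"
    for l A B P Q :: real
    by (simp add: algebra_simps)
  have run_le: "exp (\<beta> * w') * run ?U' m t ?f x \<le> exp (\<beta> * w) * run ?U m t ?f x" if x: "x \<in> tours n" for x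
    unfolding k
  proof (rule exp_run_indicator_mono[where T = "\<lambda>x. e \<in> x" and B = t and \<gamma> = \<gamma> and R = "\<lambda>x. \<beta> * tour_length (W(e := 0)) x"])
    show "2 * exp 4 * real ((card (two_opt n (standard_tour n)))\<^sup>2) * (9 * (real n)\<^sup>2 / 2) * real t * \<gamma> \<le> 1"
      using g by (simp add: D_def)
    show "admissible t (?U j)" "admissible t (?U' j)" if "j \<in> {1..Suc k}" for j
      using that w by (auto intro!: adm simp del: of_nat_Suc simp flip: k)
    show "close (\<beta> * w - \<beta> * w') (?U j) (?U' j)" if j: "j \<in> {1..Suc k}" for j
      unfolding close_def
    proof (intro ballI)
      fix x y assume x: "x \<in> tours n" and "y \<in> two_opt n x"
      then have y: "y \<in> tours n" using two_opt_subset[OF n3] by auto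
      have "?U j y - ?U j x - (?U' j y - ?U' j x) = ln (real j) / a * (w - w') * (?f y - ?f x)"
        unfolding energy_def tour_length_update[OF x, of W e w] tour_length_update[OF y, of W e w]
          tour_length_update[OF x, of W e w'] tour_length_update[OF y, of W e w']
        by (rule bilinear)
      also have "\<bar>\<dots>\<bar> \<le> \<beta> * (w - w') * 1"
      proof -
        have "0 \<le> ln (real j) / a" "ln (real j) / a \<le> \<beta>"
          using j k a0 by (auto simp: \<beta>_def divide_right_mono)
        then show ?thesis
          unfolding abs_mult using w \<beta> by (intro mult_mono) auto
      qed
      finally show "\<bar>?U j y - ?U j x - (?U' j y - ?U' j x)\<bar> \<le> \<beta> * w - \<beta> * w'"
        by (simp add: algebra_simps)
    qed
    show "0 \<le> \<beta> * tour_length (W(e := 0)) x" if "x \<in> tours n" for x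
    proof -
      have "0 \<le> tour_length (W(e := 0)) x"
        by (rule tour_length_bounds(1)[OF _ that]) (rule upd, auto)
      then show ?thesis using \<beta> by simp
    qed
    show "?U (Suc k) x = \<beta> * tour_length (W(e := 0)) x + \<beta> * w * ?f x" if "x \<in> tours n" for x
      unfolding energy_def tour_length_update[OF that, of W e w] k[symmetric] \<beta>_def[symmetric]
      by (simp add: algebra_simps)
    show "?U' (Suc k) x = \<beta> * tour_length (W(e := 0)) x + \<beta> * w' * ?f x" if "x \<in> tours n" for x
      unfolding energy_def tour_length_update[OF that, of W e w'] k[symmetric] \<beta>_def[symmetric]
      by (simp add: algebra_simps)
    show "2 * exp 2 * (t * real (card (tours n))) ^ 3 * exp (- (\<gamma> / 2 * m (Suc k)))
        * (2 * real (m (Suc k)) * exp (\<gamma> / 2) + 2 * real (Suc k) * (1 + 2 / \<gamma>)) \<le> 1"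
      using sm unfolding k .
  qed (use \<gamma>(1) bw x in auto)
  have "exp (\<beta> * w') * edge_prob a m p t (W(e := w')) e = (\<Sum>x\<in>tours n. pmf p x * (exp (\<beta> * w') * run ?U' m t ?f x))"
    using p finite_tours by (simp add: edge_prob_def sa_law_run expectation_finite sum_distrib_left mult_ac)
  also have "\<dots> \<le> (\<Sum>x\<in>tours n. pmf p x * (exp (\<beta> * w) * run ?U m t ?f x))"
    by (intro sum_mono mult_left_mono run_le) auto
  also have "\<dots> = exp (\<beta> * w) * edge_prob a m p t (W(e := w)) e"
    using p finite_tours by (simp add: edge_prob_def sa_law_run expectation_finite sum_distrib_left mult_ac)
  finally show ?thesis .
qed

end

section \<open>Averaging over the edge weights\<close>

abbreviation unit_weight :: "real measure" where
  "unit_weight \<equiv> uniform_measure lborel {0..1}"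

lemma prob_space_unit_weight: "prob_space unit_weight"
  by (rule prob_space_uniform_measure) auto

lemma AE_unit_weight: "AE w in unit_weight. w \<in> {0..1}"
  by (rule AE_uniform_measureI) auto

lemma integral_unit_weight:
  fixes f F :: "real \<Rightarrow> real"
  assumes "\<And>x. x \<in> {0..1} \<Longrightarrow> (F has_real_derivative f x) (at x)" and f: "continuous_on UNIV f"
  shows "(\<integral>w. f w \<partial>unit_weight) = F 1 - F 0"
proof -
  have "unit_weight = density lborel (\<lambda>x. ennreal (indicator {0..1} x))"
    by (simp add: uniform_measure_def divide_ennreal_def ennreal_indicator)
  then have "(\<integral>w. f w \<partial>unit_weight) = (\<integral>w. indicator {0..1} w *\<^sub>R f w \<partial>lborel)"
    using borel_measurable_continuous_onI[OF f] by (simp add: integral_density)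
  also have "\<dots> = F 1 - F 0"
    using assms
    by (intro integral_FTC_atLeastAtMost)
      (auto simp: has_real_derivative_iff_has_vector_derivative intro: has_vector_derivative_at_within continuous_on_subset)
  finally show ?thesis .
qed

section \<open>Chebyshev's inequality for the tilted uniform law\<close>

definition tilted_mean :: "real \<Rightarrow> real" where
  "tilted_mean \<beta> = 1 / \<beta> - 1 / (exp \<beta> - 1)"

text \<open>The mean is the point of comparison in \<open>tilted_mean_correlation\<close>, where
  monotonicity is available on [0, 1] only.\<close>

lemma tilted_mean_bounds:
  assumes "\<beta> > 0"
  shows "0 \<le> tilted_mean \<beta>" "tilted_mean \<beta> \<le> 1"
proof -
  have e: "exp \<beta> - 1 > 0" using assms by simp
  have "\<beta> \<le> exp \<beta> - 1" using exp_ge_add_one_self[of \<beta>] by linarith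
  then show "0 \<le> tilted_mean \<beta>"
    using assms e by (simp add: tilted_mean_def frac_le)
  have "1 - \<beta> \<le> exp (- \<beta>)" using exp_ge_add_one_self[of "- \<beta>"] by simp
  then have "(1 - \<beta>) * exp \<beta> \<le> 1"
    by (simp add: exp_minus field_simps)
  then show "tilted_mean \<beta> \<le> 1"
    using assms e by (simp add: tilted_mean_def field_simps)
qed

lemma integral_tilted_mean:
  assumes "\<beta> > 0"
  shows "(\<integral>w. (w - tilted_mean \<beta>) * exp (- \<beta> * w) \<partial>unit_weight) = 0"
proof -
  define g where "g = tilted_mean \<beta>"
  \<comment> \<open>An antiderivative of the integrand, found by parts.\<close>
  define F where "F w = - (w - g) * exp (- \<beta> * w) / \<beta> - exp (- \<beta> * w) / \<beta>\<^sup>2" for w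
  have "(\<integral>w. (w - g) * exp (- \<beta> * w) \<partial>unit_weight) = F 1 - F 0"
    unfolding F_def
    by (rule integral_unit_weight)
      (use assms in \<open>auto intro!: derivative_eq_intros continuous_intros simp: field_simps power2_eq_square\<close>)
  also have "\<dots> = (1 - exp (- \<beta>)) / \<beta>\<^sup>2 - exp (- \<beta>) / \<beta> - g * (1 - exp (- \<beta>)) / \<beta>"
    using assms by (simp add: F_def field_simps power2_eq_square)
  also have "\<dots> = 0"
  proof -
    have "exp \<beta> - 1 > 0" using assms by simp
    then have "g * (1 - exp (- \<beta>)) = (1 - exp (- \<beta>)) / \<beta> - exp (- \<beta>)"
      using assms unfolding g_def tilted_mean_def exp_minus by (simp add: field_simps)
    then show ?thesis
      by (simp add: diff_divide_distrib power2_eq_square)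
  qed
  finally show ?thesis by (simp add: g_def)
qed

text \<open>Chebyshev's association inequality for the measure with density \<open>exp (- \<beta> w)\<close>; since
  \<open>w - g\<close> has mean 0 under it, comparing with the value at \<open>g\<close> suffices.\<close>

lemma tilted_mean_correlation:
  fixes P :: "real \<Rightarrow> real"
  assumes \<beta>: "\<beta> > 0" and P: "P \<in> borel_measurable borel" "\<And>w. \<bar>P w\<bar> \<le> 1"
    and mono: "\<And>w w'. 0 \<le> w' \<Longrightarrow> w' \<le> w \<Longrightarrow> w \<le> 1 \<Longrightarrow> exp (\<beta> * w') * P w' \<le> exp (\<beta> * w) * P w"
  shows "0 \<le> (\<integral>w. (w - tilted_mean \<beta>) * P w \<partial>unit_weight)"
proof -
  interpret prob_space unit_weight by (rule prob_space_unit_weight)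
  define g where "g = tilted_mean \<beta>"
  have g: "0 \<le> g" "g \<le> 1" using tilted_mean_bounds[OF \<beta>] by (auto simp: g_def)
  define c where "c = exp (\<beta> * g) * P g"
  have "0 = c * (\<integral>w. (w - g) * exp (- \<beta> * w) \<partial>unit_weight)"
    using integral_tilted_mean[OF \<beta>] by (simp add: g_def)
  also have "\<dots> = (\<integral>w. c * ((w - g) * exp (- \<beta> * w)) \<partial>unit_weight)"
    by simp
  also have "\<dots> \<le> (\<integral>w. (w - g) * P w \<partial>unit_weight)"
  proof (rule integral_mono_AE)
    show "integrable unit_weight (\<lambda>w. c * ((w - g) * exp (- \<beta> * w)))"
    proof (rule integrable_const_bound)
      show "AE w in unit_weight. norm (c * ((w - g) * exp (- \<beta> * w))) \<le> \<bar>c\<bar> * (1 * 1)"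
        using AE_unit_weight
      proof eventually_elim
        case (elim w)
        then show ?case
          unfolding real_norm_def abs_mult using g \<beta> by (intro mult_left_mono mult_mono) auto
      qed
    qed simp
    show "integrable unit_weight (\<lambda>w. (w - g) * P w)"
    proof (rule integrable_const_bound)
      show "AE w in unit_weight. norm ((w - g) * P w) \<le> 1 * 1"
        using AE_unit_weight
      proof eventually_elim
        case (elim w)
        then show ?case
          unfolding real_norm_def abs_mult using g P(2) by (intro mult_mono) auto
      qed
    qed (use P(1) in simp)
    show "AE w in unit_weight. c * ((w - g) * exp (- \<beta> * w)) \<le> (w - g) * P w"
      using AE_unit_weight
    proof eventually_elim
      case (elim w)
      have "(w - g) * c \<le> (w - g) * (exp (\<beta> * w) * P w)"
      proof (cases "w \<ge> g")
        case True
        then show ?thesis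
          using mono[of g w] g elim by (intro mult_left_mono) (auto simp: c_def)
      next
        case False
        then show ?thesis
          using mono[of w g] g elim by (intro mult_left_mono_neg) (auto simp: c_def)
      qed
      from mult_right_mono[OF this, of "exp (- \<beta> * w)"]
      have "c * ((w - g) * exp (- \<beta> * w)) \<le> (w - g) * P w * (exp (\<beta> * w) * exp (- \<beta> * w))"
        by (simp add: mult_ac)
      then show ?case
        by (simp flip: exp_add)
    qed
  qed
  finally show ?thesis by (simp add: g_def)
qed

section \<open>Measurability in the weights\<close>

lemma measurable_weight [measurable]:
  "e \<in> edges n \<Longrightarrow> (\<lambda>W. W e) \<in> borel_measurable (weight_measure n)"
proof -
  assume "e \<in> edges n"
  then have "(\<lambda>W. W e) \<in> weight_measure n \<rightarrow>\<^sub>M unit_weight"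
    unfolding weight_measure_def by (rule measurable_component_singleton)
  also have "weight_measure n \<rightarrow>\<^sub>M unit_weight = borel_measurable (weight_measure n)"
    by (rule measurable_cong_sets) simp_all
  finally show ?thesis .
qed

lemma prob_space_weight_measure: "prob_space (weight_measure n)"
  unfolding weight_measure_def by (intro prob_space_PiM prob_space_unit_weight)

lemma AE_weight_measure: "AE W in PiM I (\<lambda>_. unit_weight). \<forall>e\<in>I. 0 \<le> W e \<and> W e \<le> 1" if "finite I"
  using that AE_unit_weight
  by (intro eventually_ball_finite ballI AE_PiM_component prob_space_unit_weight) auto

context large_tours
begin

text \<open>The observable may depend on the weights because the recursion hands the function
  evolved by the last epoch, which depends on them, to the earlier epochs.\<close>

lemma measurable_run:
  assumes "\<And>x. x \<in> tours n \<Longrightarrow> (\<lambda>W. F W x) \<in> borel_measurable (weight_measure n)" and "x \<in> tours n"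
  shows "(\<lambda>W. run (energy a W) m k (F W) x) \<in> borel_measurable (weight_measure n)"
proof -
  have energy: "(\<lambda>W. energy a W k x) \<in> borel_measurable (weight_measure n)" if "x \<in> tours n" for x k
    unfolding energy_def tour_length_def
    using tour_subset_edges[OF n3 that] by (intro borel_measurable_times borel_measurable_const borel_measurable_sum measurable_weight) auto
  have step: "(\<lambda>W. step (energy a W k) (F W) x) \<in> borel_measurable (weight_measure n)"
    if F: "\<And>x. x \<in> tours n \<Longrightarrow> (\<lambda>W. F W x) \<in> borel_measurable (weight_measure n)" and x: "x \<in> tours n"
    for F k x
  proof -
    have "(\<lambda>W. acc (energy a W k) x y) \<in> borel_measurable (weight_measure n)" if "y \<in> tours n" for y
    proof -
      note [measurable] = energy[OF x] energy[OF that]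
      show ?thesis unfolding acc_def by measurable
    qed
    moreover have "y \<in> tours n" if "y \<in> two_opt n x" for y
      using that two_opt_subset[OF n3] by blast
    ultimately show ?thesis
      unfolding step_def
      by (intro borel_measurable_add borel_measurable_divide borel_measurable_sum borel_measurable_times
          borel_measurable_diff borel_measurable_const F x) auto
  qed
  have steps: "(\<lambda>W. (step (energy a W k) ^^ s) (F W) x) \<in> borel_measurable (weight_measure n)"
    if F: "\<And>x. x \<in> tours n \<Longrightarrow> (\<lambda>W. F W x) \<in> borel_measurable (weight_measure n)" and x: "x \<in> tours n"
    for F k x s
    using x
  proof (induction s arbitrary: x)
    case (Suc s)
    then show ?case by (simp add: step)
  qed (simp add: F)
  show ?thesis
    using assms by (induction k arbitrary: F) (simp_all add: steps)
qed

section \<open>Decomposition of the length over the edges\<close>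

lemma edge_prob_bounds:
  assumes "set_pmf p \<subseteq> tours n"
  shows "0 \<le> edge_prob a m p t W e" "edge_prob a m p t W e \<le> 1"
proof -
  have q: "set_pmf (sa_law n W a m p t) \<subseteq> tours n" by (rule sa_law_run(1)[OF assms])
  have "edge_prob a m p t W e = (\<Sum>x\<in>tours n. pmf (sa_law n W a m p t) x * of_bool (e \<in> x))"
    unfolding edge_prob_def by (rule expectation_finite[OF q finite_tours])
  moreover have "(\<Sum>x\<in>tours n. pmf (sa_law n W a m p t) x * of_bool (e \<in> x)) \<le> (\<Sum>x\<in>tours n. pmf (sa_law n W a m p t) x)"
    by (intro sum_mono) auto
  ultimately show "0 \<le> edge_prob a m p t W e" "edge_prob a m p t W e \<le> 1"
    using sum_pmf_eq_1[OF finite_tours q] by (auto intro: sum_nonneg)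
qed

lemma measurable_edge_prob:
  assumes "set_pmf p \<subseteq> tours n"
  shows "(\<lambda>W. edge_prob a m p t W e) \<in> borel_measurable (weight_measure n)"
  unfolding edge_prob_def sa_law_run(2)[OF assms] expectation_finite[OF assms finite_tours]
  by (intro borel_measurable_sum borel_measurable_times borel_measurable_const measurable_run)

lemma sum_edge_prob:
  assumes p: "set_pmf p \<subseteq> tours n"
  shows "(\<Sum>e\<in>edges n. edge_prob a m p t W e) = n"
    and "measure_pmf.expectation (sa_law n W a m p t) (tour_length W) = (\<Sum>e\<in>edges n. W e * edge_prob a m p t W e)"
proof -
  define q where "q = sa_law n W a m p t"
  have q: "set_pmf q \<subseteq> tours n" unfolding q_def by (rule sa_law_run(1)[OF p])
  have P: "edge_prob a m p t W e = (\<Sum>x\<in>tours n. pmf q x * of_bool (e \<in> x))" for e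
    unfolding edge_prob_def q_def[symmetric] by (rule expectation_finite[OF q finite_tours])
  \<comment> \<open>The weights \<open>V\<close> that are summed are separated from the weights
    \<open>W\<close> that drive the chain: \<open>V = W\<close> gives the expected length, and
    \<open>V = 1\<close> gives the total n because every tour has n edges.\<close>
  have sum: "(\<Sum>e\<in>edges n. V e * edge_prob a m p t W e) = measure_pmf.expectation q (tour_length V)" for V
  proof -
    have "tour_length V x = (\<Sum>e\<in>edges n. V e * of_bool (e \<in> x))" if "x \<in> tours n" for x
      using tour_subset_edges[OF n3 that] finite_edges[of n]
      by (simp add: tour_length_def of_bool_def sum.If_cases Int_absorb1 if_distrib cong: if_cong)
    then have "measure_pmf.expectation q (tour_length V) = (\<Sum>x\<in>tours n. \<Sum>e\<in>edges n. pmf q x * (V e * of_bool (e \<in> x)))"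
      unfolding expectation_finite[OF q finite_tours] by (simp add: sum_distrib_left)
    also have "\<dots> = (\<Sum>e\<in>edges n. \<Sum>x\<in>tours n. pmf q x * (V e * of_bool (e \<in> x)))"
      by (rule sum.swap)
    finally show ?thesis
      by (simp add: P sum_distrib_left mult_ac)
  qed
  show "measure_pmf.expectation (sa_law n W a m p t) (tour_length W) = (\<Sum>e\<in>edges n. W e * edge_prob a m p t W e)"
    using sum[of W] by (simp add: q_def)
  have "measure_pmf.expectation q (tour_length (\<lambda>_. 1)) = (\<Sum>x\<in>tours n. pmf q x * n)"
    unfolding expectation_finite[OF q finite_tours] using card_tour[OF n3]
    by (intro sum.cong) (auto simp: tour_length_def)
  also have "\<dots> = n"
    using sum_pmf_eq_1[OF finite_tours q] by (simp flip: sum_distrib_right)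
  finally show "(\<Sum>e\<in>edges n. edge_prob a m p t W e) = n"
    using sum[of "\<lambda>_. 1"] by simp
qed

text \<open>Independence allows all other weights to be frozen; for almost every choice of them the
  integral over the weight of \<open>e\<close> alone is nonnegative by
  \<open>tilted_mean_correlation\<close>.\<close>

lemma integral_edge_nonneg:
  fixes a \<beta> :: real
  assumes p: "set_pmf p \<subseteq> tours n" and \<beta>: "\<beta> > 0" and e: "e \<in> edges n"
    and mono: "\<And>W w w'. (\<And>g. g \<in> edges n \<Longrightarrow> 0 \<le> W g \<and> W g \<le> 1) \<Longrightarrow> 0 \<le> w' \<Longrightarrow> w' \<le> w \<Longrightarrow> w \<le> 1 \<Longrightarrow>
      exp (\<beta> * w') * edge_prob a m p t (W(e := w')) e \<le> exp (\<beta> * w) * edge_prob a m p t (W(e := w)) e"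
  shows "0 \<le> (\<integral>W. (W e - tilted_mean \<beta>) * edge_prob a m p t W e \<partial>weight_measure n)"
    and "integrable (weight_measure n) (\<lambda>W. W e * edge_prob a m p t W e)"
    and "integrable (weight_measure n) (\<lambda>W. edge_prob a m p t W e)"
proof -
  interpret weight: prob_space "weight_measure n" by (rule prob_space_weight_measure)
  interpret product_sigma_finite "\<lambda>_ :: nat set. unit_weight"
    by unfold_locales (intro sigma_finite_measure.sigma_finite_countable prob_space_imp_sigma_finite prob_space_unit_weight)
  note [measurable] = measurable_edge_prob[OF p]
  note bounds = edge_prob_bounds[OF p]
  define I where "I = edges n - {e}"
  have I: "finite I" "e \<notin> I" "insert e I = edges n"
    using e finite_edges by (auto simp: I_def)
  show int1: "integrable (weight_measure n) (\<lambda>W. edge_prob a m p t W e)"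
    by (rule weight.integrable_const_bound[of _ 1]) (auto simp: bounds)
  show int2: "integrable (weight_measure n) (\<lambda>W. W e * edge_prob a m p t W e)"
  proof (rule weight.integrable_const_bound)
    show "AE W in weight_measure n. norm (W e * edge_prob a m p t W e) \<le> 1 * 1"
      using AE_weight_measure[OF finite_edges, of n] unfolding weight_measure_def
    proof eventually_elim
      case (elim W)
      then show ?case
        unfolding real_norm_def abs_mult using e bounds by (intro mult_mono) auto
    qed
  qed (use e in measurable)
  have int: "integrable (PiM (insert e I) (\<lambda>_. unit_weight)) (\<lambda>W. (W e - tilted_mean \<beta>) * edge_prob a m p t W e)"
    using int1 int2 unfolding I weight_measure_def[symmetric] left_diff_distrib by simp
  have "0 \<le> (\<integral>W. (\<integral>w. (w - tilted_mean \<beta>) * edge_prob a m p t (W(e := w)) e \<partial>unit_weight) \<partial>PiM I (\<lambda>_. unit_weight))"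
  proof (rule integral_nonneg_AE)
    show "AE W in PiM I (\<lambda>_. unit_weight).
      0 \<le> (\<integral>w. (w - tilted_mean \<beta>) * edge_prob a m p t (W(e := w)) e \<partial>unit_weight)"
      using AE_weight_measure[OF I(1)] AE_space
    proof eventually_elim
      case (elim W)
      have "(\<lambda>w. W(e := w)) \<in> unit_weight \<rightarrow>\<^sub>M weight_measure n"
        using measurable_component_update[OF elim(2) I(2)] unfolding I weight_measure_def .
      from measurable_compose[OF this measurable_edge_prob[OF p]]
      have "(\<lambda>w. edge_prob a m p t (W(e := w)) e) \<in> borel_measurable borel"
        by (simp cong: measurable_cong_sets)
      \<comment> \<open>A point of the product over \<open>I\<close> is \<open>undefined\<close> at
        \<open>e\<close>. Putting 0 there gives weights in [0, 1] on all edges, and the later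
        updates at \<open>e\<close> overwrite this value.\<close>
      moreover have "0 \<le> (W(e := 0)) g \<and> (W(e := 0)) g \<le> 1" if "g \<in> edges n" for g
        using elim(1) I(3) that by auto
      from mono[where W = "W(e := 0)", OF this] have "exp (\<beta> * w') * edge_prob a m p t (W(e := w')) e \<le> exp (\<beta> * w) * edge_prob a m p t (W(e := w)) e"
        if "0 \<le> w'" "w' \<le> w" "w \<le> 1" for w w'
        using that by simp
      ultimately show ?case
        using bounds by (intro tilted_mean_correlation[OF \<beta>]) auto
    qed
  qed
  then show "0 \<le> (\<integral>W. (W e - tilted_mean \<beta>) * edge_prob a m p t W e \<partial>weight_measure n)"
    using product_integral_insert[OF I(1,2) int] unfolding I weight_measure_def by simp
qed

lemma expected_final_length_ge:
  fixes a \<beta> :: real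
  assumes p: "set_pmf p \<subseteq> tours n" and \<beta>: "\<beta> > 0"
    and mono: "\<And>e W w w'. (\<And>g. g \<in> edges n \<Longrightarrow> 0 \<le> W g \<and> W g \<le> 1) \<Longrightarrow> 0 \<le> w' \<Longrightarrow> w' \<le> w \<Longrightarrow> w \<le> 1 \<Longrightarrow>
      exp (\<beta> * w') * edge_prob a m p t (W(e := w')) e \<le> exp (\<beta> * w) * edge_prob a m p t (W(e := w)) e"
  shows "n * tilted_mean \<beta> \<le> expected_final_length n a m p t"
proof -
  interpret weight: prob_space "weight_measure n" by (rule prob_space_weight_measure)
  have edge: "0 \<le> (\<integral>W. (W e - tilted_mean \<beta>) * edge_prob a m p t W e \<partial>weight_measure n)"
    "integrable (weight_measure n) (\<lambda>W. W e * edge_prob a m p t W e)"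
    "integrable (weight_measure n) (\<lambda>W. edge_prob a m p t W e)" if "e \<in> edges n" for e
    by (rule integral_edge_nonneg[OF p \<beta> that], rule mono, blast+)+
  have "expected_final_length n a m p t - n * tilted_mean \<beta>
      = (\<integral>W. (\<Sum>e\<in>edges n. W e * edge_prob a m p t W e) \<partial>weight_measure n)
        - (\<integral>W. (\<Sum>e\<in>edges n. tilted_mean \<beta> * edge_prob a m p t W e) \<partial>weight_measure n)"
    by (simp add: expected_final_length_def sum_edge_prob[OF p] weight.prob_space flip: sum_distrib_left)
  also have "\<dots> = (\<integral>W. (\<Sum>e\<in>edges n. (W e - tilted_mean \<beta>) * edge_prob a m p t W e) \<partial>weight_measure n)"
    using edge(2,3) by (simp add: left_diff_distrib sum_subtractf)
  also have "\<dots> = (\<Sum>e\<in>edges n. \<integral>W. (W e - tilted_mean \<beta>) * edge_prob a m p t W e \<partial>weight_measure n)"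
    using edge(2,3) by (intro Bochner_Integration.integral_sum) (simp add: left_diff_distrib)
  also have "\<dots> \<ge> 0"
    using edge(1) by (intro sum_nonneg)
  finally show ?thesis by simp
qed

end

section \<open>The length of the final tour\<close>

lemma mixing_error_small:
  fixes t n s :: nat and c :: real
  defines "K \<equiv> 9 * 65536 * exp 4 :: real"
  defines "\<gamma> \<equiv> 1 / (K * real n ^ 6 * real t)"
  assumes n: "n \<ge> 1" and t: "t \<ge> 1"
    and s: "real s \<ge> c * (real n ^ 9 * real t ^ 2 * ln (real n))"
    and large: "ln (60 * exp 2 * K) + 5 + (3 * real n + 6) * ln (real n) \<le> c / (4 * K) * real n ^ 3 * ln (real n)"
  shows "2 * exp 2 * (t * real n ^ n) ^ 3 * exp (- (\<gamma> / 2 * s))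
        * (2 * real s * exp (\<gamma> / 2) + 2 * real t * (1 + 2 / \<gamma>)) \<le> 1"
proof -
  have K: "K \<ge> 1" by (simp add: K_def mult_ge1_I)
  define N where "N = real n"
  define T where "T = real t"
  have NT: "N \<ge> 1" "T \<ge> 1" using n t by (auto simp: N_def T_def)
  have "K * N ^ 6 * T \<ge> 1 * 1 * 1"
    using K NT by (intro mult_mono) auto
  then have \<gamma>: "0 < \<gamma>" "\<gamma> \<le> 1"
    by (auto simp: \<gamma>_def N_def T_def)
  \<comment> \<open>Half of the exponent is spent on absorbing the factor \<open>s\<close>, the
    other half on the number of tours.\<close>
  define E where "E = exp (- (\<gamma> * s / 4))"
  have E: "0 < E" "E \<le> 1" using \<gamma> by (auto simp: E_def)
  have "\<gamma> * s / 4 * E \<le> exp (\<gamma> * s / 4) * E"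
    using exp_ge_add_one_self[of "\<gamma> * s / 4"] E by (intro mult_right_mono) linarith+
  also have "\<dots> = 1" by (simp add: E_def flip: exp_add)
  finally have sE: "s * E \<le> 4 / \<gamma>"
    using \<gamma> by (simp add: field_simps)
  have e3: "exp (\<gamma> / 2) \<le> 3"
  proof -
    have "exp (\<gamma> / 2) \<le> exp 1" using \<gamma> by simp
    then show ?thesis using exp_le by linarith
  qed
  have "E * (2 * s * exp (\<gamma> / 2)) = 2 * (s * E) * exp (\<gamma> / 2)" by simp
  also have "\<dots> \<le> 2 * (4 / \<gamma>) * 3"
    using sE e3 \<gamma> E by (intro mult_mono) auto
  also have "\<dots> \<le> T * (24 / \<gamma>)"
    using NT \<gamma> by (simp add: field_simps)
  finally have 1: "E * (2 * s * exp (\<gamma> / 2)) \<le> T * (24 / \<gamma>)" .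
  have 2: "E * (2 * T * (1 + 2 / \<gamma>)) \<le> 1 * (2 * T * (3 / \<gamma>))"
    using E NT \<gamma> by (intro mult_mono) (auto simp: field_simps)
  have "E * (2 * s * exp (\<gamma> / 2) + 2 * T * (1 + 2 / \<gamma>)) \<le> T * (24 / \<gamma>) + 1 * (2 * T * (3 / \<gamma>))"
    unfolding distrib_left[of E] by (rule add_mono[OF 1 2])
  also have "\<dots> = T * (30 / \<gamma>)"
    using \<gamma> by (simp add: field_simps)
  also have "\<dots> = 30 * K * N ^ 6 * T ^ 2"
    by (simp add: \<gamma>_def N_def T_def power2_eq_square)
  finally have bracket: "E * (2 * s * exp (\<gamma> / 2) + 2 * T * (1 + 2 / \<gamma>)) \<le> 30 * K * N ^ 6 * T ^ 2" .
  have "2 * exp 2 * (T * N ^ n) ^ 3 * exp (- (\<gamma> / 2 * s)) * (2 * s * exp (\<gamma> / 2) + 2 * T * (1 + 2 / \<gamma>))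
      = (2 * exp 2 * (T * N ^ n) ^ 3 * E) * (E * (2 * s * exp (\<gamma> / 2) + 2 * T * (1 + 2 / \<gamma>)))"
  proof -
    have "exp (- (\<gamma> / 2 * s)) = E * E" by (simp add: E_def flip: exp_add)
    then show ?thesis by (simp only: mult_ac)
  qed
  also have "\<dots> \<le> (2 * exp 2 * (T * N ^ n) ^ 3 * E) * (30 * K * N ^ 6 * T ^ 2)"
    using bracket E NT by (intro mult_left_mono) auto
  also have "\<dots> = (60 * exp 2 * K) * T ^ 5 * N ^ (3 * n + 6) * E"
  proof -
    have "N ^ (3 * n + 6) = (N ^ n) ^ 3 * N ^ 6" "T ^ 5 = T ^ 3 * T ^ 2"
      by (simp_all add: power_add mult.commute flip: power_mult)
    then show ?thesis
      by (simp add: power_mult_distrib)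
  qed
  also have "\<dots> = exp (ln (60 * exp 2 * K) + 5 * ln T + (3 * N + 6) * ln N - \<gamma> * s / 4)"
  proof -
    have "T ^ 5 = exp (5 * ln T)" using NT exp_of_nat_mult[of 5 "ln T"] by simp
    moreover have "N ^ (3 * n + 6) = exp ((3 * N + 6) * ln N)"
      using NT exp_of_nat_mult[of "3 * n + 6" "ln N"] by (simp add: N_def)
    moreover have "60 * exp 2 * K = exp (ln (60 * exp 2 * K))" using K by simp
    ultimately show ?thesis by (simp only: E_def exp_add exp_diff exp_minus divide_inverse)
  qed
  also have "\<dots> \<le> 1"
  proof -
    \<comment> \<open>After multiplication by \<gamma> one factor \<open>T\<close> of the epoch
      length survives. It pays for 5 * ln T, coming from the power \<open>T ^ 5\<close>, and
      multiplies the remaining terms because these are nonnegative.\<close>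
    define X where "X = ln (60 * exp 2 * K) + (3 * N + 6) * ln N"
    have "60 * exp 2 * K \<ge> 1 * 1 * 1"
      using K by (intro mult_mono) auto
    then have X: "X \<ge> 0" using NT by (simp add: X_def)
    have "5 * ln T \<le> 5 * T" using NT ln_le_minus_one[of T] by simp
    moreover have "X \<le> T * X" using mult_right_mono[OF NT(2) X] by simp
    ultimately have "5 * ln T + X \<le> T * (X + 5)" by (simp add: algebra_simps)
    also have "\<dots> \<le> T * (c / (4 * K) * N ^ 3 * ln N)"
      using large NT by (intro mult_left_mono) (auto simp: X_def N_def)
    also have "\<dots> = \<gamma> * (c * (N ^ 9 * T ^ 2 * ln N)) / 4"
      using K NT by (simp add: \<gamma>_def N_def[symmetric] T_def[symmetric] power2_eq_square eval_nat_numeral mult_ac)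
    also have "\<dots> \<le> \<gamma> * s / 4"
      using s \<gamma> by (simp add: N_def T_def)
    finally show ?thesis by (simp add: X_def)
  qed
  finally show ?thesis by (simp add: N_def T_def)
qed

theorem theorem3:
  fixes t :: "nat \<Rightarrow> nat" and a :: "nat \<Rightarrow> real" and m :: "nat \<Rightarrow> nat \<Rightarrow> nat"
    and p :: "nat \<Rightarrow> nat set set pmf"
  assumes "\<And>n. n \<ge> 3 \<Longrightarrow> t n \<ge> 2"
    and "(\<lambda>n. log 2 (real (t n))) \<in> o(\<lambda>n. real n)"
    and "\<And>n. n \<ge> 3 \<Longrightarrow> a n \<ge> real n"
    and "(\<lambda>(n, k). real (m n k)) \<in>
           \<Omega>[at_top \<times>\<^sub>F principal {1..}](\<lambda>(n, k). real n ^ 9 * real k ^ 2 * ln (real n))"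
    and "\<And>n. n \<ge> 3 \<Longrightarrow> set_pmf (p n) \<subseteq> tours n"
  shows "\<forall>\<^sub>F n in at_top.
           expected_final_length n (a n) (m n) (p n) (t n)
             \<ge> real n * (a n / ln (real (t n)) - 1 / (real (t n) powr (1 / a n) - 1))"
proof -
  define K where "K = 9 * 65536 * exp (4 :: real)"
  have K: "K > 0" by (simp add: K_def)
  obtain c where c: "c > 0" and
    "\<forall>\<^sub>F x in at_top \<times>\<^sub>F principal {1..}. norm (case x of (n, k) \<Rightarrow> real (m n k))
      \<ge> c * norm (case x of (n, k) \<Rightarrow> real n ^ 9 * real k ^ 2 * ln (real n))"
    using landau_omega.bigE[OF assms(4)] by blast
  \<comment> \<open>The factor \<open>principal {1..}\<close> of the filter makes \<open>c\<close>
    and the threshold for n uniform over all epochs k \<ge> 1, so the bound may be used at k = t n,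
    which varies with n.\<close>
  then obtain Pf Pg where Pf: "\<forall>\<^sub>F n in at_top. Pf n" and Pg: "\<forall>\<^sub>F k in principal {1..}. Pg k"
    and le: "\<And>n k. Pf n \<Longrightarrow> Pg k \<Longrightarrow> real (m n k) \<ge> c * \<bar>real n ^ 9 * real k ^ 2 * ln (real n)\<bar>"
    unfolding eventually_prod_filter by auto
  define C where "C = c / (4 * K)"
  have "C > 0" using c K by (simp add: C_def)
  have "\<forall>\<^sub>F n :: nat in at_top. ln (60 * exp 2 * K) + 5 + (3 * real n + 6) * ln (real n) \<le> C * real n ^ 3 * ln (real n)"
    using \<open>C > 0\<close> by real_asymp
  \<comment> \<open>With constant 1 this gives t n \<le> 2^n, hence ln (t n) \<le> n \<le> a n:
    inverse temperatures stay at most 1.\<close>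
  moreover have "\<forall>\<^sub>F n in at_top. norm (log 2 (real (t n))) \<le> 1 * norm (real n)"
    using landau_o.smallD[OF assms(2), of 1] by simp
  moreover have "\<forall>\<^sub>F n :: nat in at_top. n \<ge> 9" by (rule eventually_ge_at_top)
  ultimately show ?thesis
    using Pf
  proof eventually_elim
    case (elim n)
    interpret large_tours n by unfold_locales (fact elim)
    let ?t = "t n" and ?a = "a n"
    define \<beta> where "\<beta> = ln (real ?t) / ?a"
    define \<gamma> where "\<gamma> = 1 / (K * real n ^ 6 * real ?t)"
    have t: "?t \<ge> 2" and a: "?a \<ge> real n" and p: "set_pmf (p n) \<subseteq> tours n"
      using assms(1,3,5)[OF n3] by auto
    have a0: "?a > 0" using a elim by linarith
    have lt: "ln (real ?t) > 0" using t by simp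
    have \<beta>: "\<beta> > 0" using lt a0 by (simp add: \<beta>_def)
    have "ln (real ?t) = log 2 (real ?t) * ln 2"
      by (simp add: log_def)
    also have "\<dots> \<le> log 2 (real ?t) * 1"
      using t ln_2_less_1 by (intro mult_left_mono) auto
    also have "\<dots> \<le> real n" using elim by simp
    finally have lta: "ln (real ?t) \<le> ?a" using a by simp
    have \<gamma>: "\<gamma> > 0" "2 * exp 4 * (256 * real n ^ 2)\<^sup>2 * (9 * real n ^ 2 / 2) * ?t * \<gamma> \<le> 1"
    proof -
      show "\<gamma> > 0" using K elim t by (simp add: \<gamma>_def)
      have "2 * exp 4 * (256 * real n ^ 2)\<^sup>2 * (9 * real n ^ 2 / 2) * ?t = K * real n ^ 6 * ?t"
        by (simp add: K_def power_mult_distrib flip: power_mult power_add)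
      moreover have "K * real n ^ 6 * ?t * \<gamma> = 1"
        using K elim t by (simp add: \<gamma>_def)
      ultimately show "2 * exp 4 * (256 * real n ^ 2)\<^sup>2 * (9 * real n ^ 2 / 2) * ?t * \<gamma> \<le> 1"
        by (simp only:)
    qed
    have "Pg ?t" using Pg t by (auto simp: eventually_principal)
    then have m: "real (m n ?t) \<ge> c * (real n ^ 9 * real ?t ^ 2 * ln (real n))"
      using le[OF \<open>Pf n\<close>, of ?t] elim by (simp add: abs_mult)
    have small: "2 * exp 2 * (?t * real n ^ n) ^ 3 * exp (- (\<gamma> / 2 * m n ?t))
        * (2 * real (m n ?t) * exp (\<gamma> / 2) + 2 * real ?t * (1 + 2 / \<gamma>)) \<le> 1"
      unfolding \<gamma>_def K_def
      by (rule mixing_error_small[OF _ _ m]) (use t elim in \<open>auto simp: C_def K_def\<close>)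
    have "n * tilted_mean \<beta> \<le> expected_final_length n ?a (m n) (p n) ?t"
    proof (rule expected_final_length_ge[OF p \<beta>])
      fix e :: "nat set" and W :: "nat set \<Rightarrow> real" and w w' :: real
      assume W: "\<And>g. g \<in> edges n \<Longrightarrow> 0 \<le> W g \<and> W g \<le> 1" and w: "0 \<le> w'" "w' \<le> w" "w \<le> 1"
      show "exp (\<beta> * w') * edge_prob ?a (m n) (p n) ?t (W(e := w')) e \<le> exp (\<beta> * w) * edge_prob ?a (m n) (p n) ?t (W(e := w)) e"
        unfolding \<beta>_def
        by (rule exp_edge_prob_mono[where m = "m n" and t = ?t and W = W, OF W a _ lta p \<gamma> small w]) (use t in simp_all)
    qed
    moreover have "exp \<beta> = real ?t powr (1 / ?a)"
      using t by (simp add: powr_def \<beta>_def)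
    ultimately show ?case
      by (simp add: tilted_mean_def \<beta>_def)
  qed
qed

end
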